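(* Let $n\ge1$ and $x_1,\dots,x_{2n+1}\in[-1,1]$. Let $s_1(\omega),\ldots,s_n(\omega)\in\mathbb{C}$ denote the poles of the rational interpolant $r_\omega\in\mathcal{U}_n$ to $\mathrm{e}^{\omega z}$ with interpolation nodes $\mathrm{i} x_1,\ldots,\mathrm{i} x_{2n+1}$ (for sufficiently small $\omega>0$ it has exactly $n$ poles), and let $\widehat{s}_1,\ldots,\widehat{s}_n\in\mathbb{C}$ denote the poles of the $(n,n)$-Padé approximation to $\mathrm{e}^z$. Then, up to ordering, $$\omega s_\ell(\omega) \to \widehat{s}_\ell,\quad \ell=1,\ldots,n,\quad \omega\to 0^+.$$ Moreover, this result remains true if $r_\omega$ refers to the rational interpolant to $\mathrm{e}^{\omega z}$ with interpolation nodes $\mathrm{i} x_1(\omega),\ldots,\mathrm{i} x_{2n+1}(\omega)$, where $x_j(\omega)\in[-1,1]$ depends on $\omega$.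
   Context: For a complex polynomial $p$ let $p^\dag(z):=\overline{p}(-z)=\overline{p(-\overline z)}$, where $\overline p$ has complex-conjugated coefficients. Let $\mathcal{U}_n:=\{p^\dag/p : p \text{ a complex polynomial of degree}\le n,\ p\not\equiv 0\}$, with rational functions identified with their irreducible form. Rational interpolant: given nodes $\mathrm{i}x_1,\dots,\mathrm{i}x_{2n+1}$ with $x_j\in\mathbb{R}$, possibly repeated (counted with multiplicity), the rational interpolant of degree $(n,n)$ to $\mathrm{e}^{\omega z}$ is the rational function $r_\omega=p/q$, where $p,q$ are polynomials of degree $\le n$, not both identically zero, solving the linearized problem $$p(z)-q(z)\mathrm{e}^{\omega z}=\prod_{j=1}^{2n+1}(z-\mathrm{i}x_j)\,v(z)$$ for some entire function $v$. Such a pair always exists, the quotient $p/q$ (in irreducible form) is the same for all solutions, and it belongs to $\mathcal{U}_n$. The $(n,n)$-Padé approximation to $\mathrm{e}^z$ is the unique rational function $\widehat r=p/q$ with polynomials $p,q$ of degree $\le n$ and $q(0)=1$ such that $\widehat r(z)=\mathrm{e}^z+\mathcal{O}(|z|^{2n+1})$ for $|z|\to0$; it has exactly $n$ poles. "Up to ordering" means that the poles can be numbered so that the convergence holds. *)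

theory Defs
  imports
    "HOL-Complex_Analysis.Complex_Analysis"
    "HOL-Computational_Algebra.Computational_Algebra"
    "HOL-Computational_Algebra.Field_as_Ring"
    "HOL-Library.Landau_Symbols"
begin

text \<open>
  Rational functions are elements of the fraction field of the complex polynomials, so that two
  quotients with the same irreducible form are equal. Poles are counted with multiplicity;
  \<open>quot_of_fract\<close> returns the coprime numerator and (monic) denominator.
\<close>

definition rat_poles :: "complex poly fract \<Rightarrow> complex multiset" where
  "rat_poles r = proots (snd (quot_of_fract r))"

text \<open>
  The linearized interpolation problem for \<open>exp (\<omega> z)\<close> with nodes \<open>\<i> x\<^sub>1, \<dots>, \<i> x\<^sub>2\<^sub>n\<^sub>+\<^sub>1\<close>; a node occurring
  several times is repeated in the product, which makes the condition one of Hermite type.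
\<close>

definition solves_linearized ::
    "nat \<Rightarrow> real \<Rightarrow> (nat \<Rightarrow> real) \<Rightarrow> complex poly \<Rightarrow> complex poly \<Rightarrow> bool" where
  "solves_linearized n \<omega> x p q \<longleftrightarrow>
     degree p \<le> n \<and> degree q \<le> n \<and> \<not> (p = 0 \<and> q = 0) \<and>
     (\<exists>v. v holomorphic_on UNIV \<and>
        (\<forall>z. poly p z - poly q z * exp (complex_of_real \<omega> * z) =
             (\<Prod>j = 1..2*n+1. z - \<i> * complex_of_real (x j)) * v z))"

text \<open>
  The denominator of a solution never vanishes identically, as otherwise the numerator would be a
  nonzero polynomial of degree at most \<open>n\<close> with \<open>2n+1\<close> zeros. Hence the convention
  \<open>Fract p 0 = 0\<close> does not interfere.
\<close>

definition rat_interpolant :: "nat \<Rightarrow> real \<Rightarrow> (nat \<Rightarrow> real) \<Rightarrow> complex poly fract" where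
  "rat_interpolant n \<omega> x = (THE r. \<exists>p q. solves_linearized n \<omega> x p q \<and> r = Fract p q)"

definition pade_exp :: "nat \<Rightarrow> complex poly fract" where
  "pade_exp n =
     (THE r. \<exists>p q. degree p \<le> n \<and> degree q \<le> n \<and> poly q 0 = 1 \<and> r = Fract p q \<and>
        (\<lambda>z. poly p z / poly q z - exp z) \<in> O[at 0](\<lambda>z. complex_of_real (norm z ^ (2*n+1))))"

end

theory Submission
  imports Defs
begin

text \<open>
  After the substitution \<open>w = \<omega> z\<close> the interpolant \<open>r\<^sub>\<omega>\<close> becomes a rational interpolant of
  \<open>exp w\<close> with nodes \<open>\<i> \<omega> x\<^sub>j\<close>, all of modulus at most \<open>\<omega>\<close>, and its poles become
  \<open>\<omega> s\<^sub>l(\<omega>)\<close>. As \<open>\<omega>\<close> tends to 0, the nodes merge into a node of multiplicity \<open>2n+1\<close> at the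
  origin, and interpolation there is Pade approximation. So the claim is that the denominators of
  the interpolants, normalised to be monic, converge to the Pade denominator, and that roots depend
  continuously on coefficients. Only the bound on the moduli of the nodes enters, which is why they
  may depend on \<open>\<omega>\<close>.

  The convergence rests on compactness together with normality of the limit problem. A pair
  \<open>(p, q)\<close> that is scaled to have coefficients of total modulus 1 and satisfies
  \<open>p - q exp = v \<Prod>(z - a\<^sub>j)\<close> has a cofactor \<open>v\<close> that is bounded on the unit disc independently of
  the nodes, by the maximum modulus principle. Hence the limit pairs along shrinking nodes satisfy
  \<open>p - q exp = O(\<bar>z\<bar>\<^sup>N)\<close>, where \<open>N\<close> is the number of nodes (\<open>small_nodes_limit\<close>). On the other
  hand, a nonzero pair with \<open>m + l\<close> free coefficients cannot achieve the order \<open>m + l\<close> at 0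
  (\<open>pade_order_bound\<close>). Together they show that the same count holds for all nodes close to 0
  (\<open>small_nodes_normal\<close>), so that for small \<open>\<omega>\<close> the solutions are coprime and have a denominator
  of degree exactly \<open>n\<close> (\<open>small_nodes_degree_coprime\<close>). Since the pairs at the node 0 are unique
  up to a factor, compactness also gives convergence of the monic denominators
  (\<open>denominator_converges\<close>).

  Solutions exist by elimination (\<open>nontrivial_combination_divisible\<close>), and the continuity of roots
  is proved by splitting off one root at a time (\<open>roots_tendsto\<close>).
\<close>

section \<open>Entire functions and interpolation conditions\<close>

lemma entire_divide_root:
  assumes "f holomorphic_on UNIV" and "f a = (0::complex)"
  obtains g where "g holomorphic_on UNIV" and "\<And>z. f z = (z - a) * g z"
proof -
  have "(\<lambda>z. if z = a then deriv f a else f z / (z - a) - f a / (z - a)) holomorphic_on UNIV"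
    by (rule pole_theorem[where g = f]) (use assms in auto)
  then show ?thesis
    by (rule that) (auto simp: assms(2))
qed

lemma entire_eq_of_eq_off_point:
  fixes f g :: "complex \<Rightarrow> complex"
  assumes "f holomorphic_on UNIV" "g holomorphic_on UNIV" and "\<And>z. z \<noteq> a \<Longrightarrow> f z = g z"
  shows "f z = g z"
proof (cases "z = a")
  case True
  have "f \<midarrow>a\<rightarrow> f a" "g \<midarrow>a\<rightarrow> g a"
    using assms(1,2) holomorphic_on_imp_continuous_on
    by (metis UNIV_I continuous_within continuous_on_eq_continuous_within)+
  moreover from this(2) have "f \<midarrow>a\<rightarrow> g a"
    by (rule Lim_transform_eventually) (auto simp: eventually_at_filter assms(3))
  ultimately show ?thesis
    using LIM_unique True by blast
qed (use assms(3) in auto)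

text \<open>
  This is the count "more unknowns than linear conditions", with the conditions being the Hermite
  conditions at the nodes. Instead of setting up a linear system, one node is treated at a time:
  elimination at that node makes all but one of the functions divisible by its linear factor, and
  the quotients are again entire. A repeated node needs no special treatment in this way.
\<close>
lemma nontrivial_combination_divisible:
  fixes f :: "'i \<Rightarrow> complex \<Rightarrow> complex" and a :: "'k \<Rightarrow> complex"
  assumes "finite K" "finite I" "card K < card I" "\<And>i. i \<in> I \<Longrightarrow> f i holomorphic_on UNIV"
  shows "\<exists>c v. (\<exists>i\<in>I. c i \<noteq> 0) \<and> v holomorphic_on UNIV \<and>
           (\<forall>z. (\<Sum>i\<in>I. c i * f i z) = (\<Prod>k\<in>K. z - a k) * v z)"
  using assms
proof (induction K arbitrary: I f rule: finite_induct)
  case empty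
  then have "I \<noteq> {}"
    by auto
  moreover have "(\<lambda>z. \<Sum>i\<in>I. f i z) holomorphic_on UNIV"
    using empty by (intro holomorphic_intros) auto
  ultimately show ?case
    by (intro exI[of _ "\<lambda>_. 1"] exI[of _ "\<lambda>z. \<Sum>i\<in>I. f i z"]) auto
next
  case (insert k K)
  \<comment> \<open>A pivot \<open>p\<close> makes every other function vanish at the node \<open>a k\<close>; if all of them vanish
    there already, any index serves as the pivot.\<close>
  obtain p where p: "p \<in> I" "f p (a k) \<noteq> 0 \<or> (\<forall>i\<in>I. f i (a k) = 0)"
    using insert.prems by (metis card.empty less_nat_zero_code all_not_in_conv)
  define b where "b i = f i (a k) / f p (a k)" for i
  have "\<forall>i\<in>I. \<exists>g. g holomorphic_on UNIV \<and> (\<forall>z. f i z - b i * f p z = (z - a k) * g z)"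
  proof
    fix i assume "i \<in> I"
    then have "(\<lambda>z. f i z - b i * f p z) holomorphic_on UNIV"
      using insert.prems p by (intro holomorphic_intros) auto
    moreover have "f i (a k) - b i * f p (a k) = 0"
      using p \<open>i \<in> I\<close> by (auto simp: b_def)
    ultimately show "\<exists>g. g holomorphic_on UNIV \<and> (\<forall>z. f i z - b i * f p z = (z - a k) * g z)"
      using entire_divide_root by blast
  qed
  then obtain g where g: "\<And>i. i \<in> I \<Longrightarrow> g i holomorphic_on UNIV"
      "\<And>i z. i \<in> I \<Longrightarrow> f i z - b i * f p z = (z - a k) * g i z"
    by metis
  have "card K < card (I - {p})"
    using insert p by simp
  then obtain c v where c: "\<exists>i\<in>I - {p}. c i \<noteq> 0" "v holomorphic_on UNIV"
      "\<And>z. (\<Sum>i\<in>I - {p}. c i * g i z) = (\<Prod>k\<in>K. z - a k) * v z"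
    using insert.IH[of "I - {p}" g] g insert.prems by auto
  define c' where "c' = c(p := - (\<Sum>i\<in>I - {p}. c i * b i))"
  have "(\<Sum>i\<in>I. c' i * f i z) = (\<Prod>k\<in>insert k K. z - a k) * v z" for z
  proof -
    have "(\<Sum>i\<in>I. c' i * f i z) = c' p * f p z + (\<Sum>i\<in>I - {p}. c' i * f i z)"
      using p insert.prems by (subst sum.remove[of _ p]) auto
    also have "(\<Sum>i\<in>I - {p}. c' i * f i z) = (\<Sum>i\<in>I - {p}. c i * f i z)"
      by (intro sum.cong) (auto simp: c'_def)
    also have "c' p * f p z + \<dots> = (\<Sum>i\<in>I - {p}. c i * (f i z - b i * f p z))"
      by (simp add: c'_def sum_subtractf sum_distrib_right right_diff_distrib mult.assoc)
    also have "\<dots> = (\<Sum>i\<in>I - {p}. c i * ((z - a k) * g i z))"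
      by (intro sum.cong) (auto simp: g(2))
    also have "\<dots> = (z - a k) * (\<Sum>i\<in>I - {p}. c i * g i z)"
      by (simp add: sum_distrib_left mult_ac)
    finally show ?thesis
      using insert.hyps by (simp add: c(3))
  qed
  moreover have "\<exists>i\<in>I. c' i \<noteq> 0"
    using c(1) by (auto simp: c'_def)
  ultimately show ?case
    using c(2) by blast
qed

definition hermite_interp ::
    "(complex \<Rightarrow> complex) \<Rightarrow> 'k set \<Rightarrow> ('k \<Rightarrow> complex) \<Rightarrow> complex poly \<Rightarrow> complex poly \<Rightarrow> bool" where
  "hermite_interp E K a p q \<longleftrightarrow>
     (\<exists>v. v holomorphic_on UNIV \<and> (\<forall>z. poly p z - poly q z * E z = (\<Prod>k\<in>K. z - a k) * v z))"

lemma hermite_interpI: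
  assumes "v holomorphic_on UNIV"
    and "\<And>z. poly p z - poly q z * E z = (\<Prod>k\<in>K. z - a k) * v z"
  shows "hermite_interp E K a p q"
  using assms unfolding hermite_interp_def by blast

lemma hermite_interpE:
  assumes "hermite_interp E K a p q"
  obtains v where "v holomorphic_on UNIV"
    and "\<And>z. poly p z - poly q z * E z = (\<Prod>k\<in>K. z - a k) * v z"
  using assms unfolding hermite_interp_def by blast

lemma hermite_interp_smult:
  assumes "hermite_interp E K a p q"
  shows "hermite_interp E K a (smult c p) (smult c q)"
proof -
  obtain v where v: "v holomorphic_on UNIV"
      "\<And>z. poly p z - poly q z * E z = (\<Prod>k\<in>K. z - a k) * v z"
    using assms by (rule hermite_interpE) (rule that)
  have "poly (smult c p) z - poly (smult c q) z * E z = (\<Prod>k\<in>K. z - a k) * (c * v z)" for z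
    using v(2)[of z] by (simp add: mult.left_commute right_diff_distrib[symmetric] mult.assoc)
  then show ?thesis
    using v(1) by (intro hermite_interpI[where v = "\<lambda>z. c * v z"] holomorphic_intros)
qed

lemma degree_less_if_coeffs_vanish:
  assumes "\<And>i. m \<le> i \<Longrightarrow> coeff p i = 0" and "p \<noteq> 0"
  shows "degree p < m"
  using assms by (metis leading_coeff_0_iff not_le)

text \<open>
  The bounds count coefficients rather than degrees, so that the value 0 forces a polynomial to
  vanish; inductions on the bounds can then start from there.
\<close>
lemma hermite_interp_exists:
  assumes "E holomorphic_on UNIV" and "finite K" and "card K < m + l"
  shows "\<exists>p q. (p \<noteq> 0 \<or> q \<noteq> 0) \<and> (\<forall>i\<ge>m. coeff p i = 0) \<and> (\<forall>i\<ge>l. coeff q i = 0) \<and>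
    hermite_interp E K a p q"
proof -
  define f where "f = case_sum (\<lambda>i z. z ^ i) (\<lambda>i z. - (z ^ i * E z))"
  have "f t holomorphic_on UNIV" for t
    by (cases t) (use assms(1) in \<open>auto simp: f_def intro!: holomorphic_intros\<close>)
  then obtain c v where c: "\<exists>t\<in>{..<m} <+> {..<l}. c t \<noteq> 0" and v: "v holomorphic_on UNIV"
      "\<And>z. (\<Sum>t\<in>{..<m} <+> {..<l}. c t * f t z) = (\<Prod>k\<in>K. z - a k) * v z"
    using nontrivial_combination_divisible[of K "{..<m} <+> {..<l}" f a] assms(2,3)
    by (auto simp: card_Plus)
  define p where "p = (\<Sum>i<m. monom (c (Inl i)) i)"
  define q where "q = (\<Sum>i<l. monom (c (Inr i)) i)"
  have coeff_p: "coeff p i = (if i < m then c (Inl i) else 0)"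
    and coeff_q: "coeff q i = (if i < l then c (Inr i) else 0)" for i
    by (simp_all add: p_def q_def coeff_sum)
  have "p \<noteq> 0 \<or> q \<noteq> 0"
    using c coeff_p coeff_q by (metis PlusE coeff_0 lessThan_iff)
  moreover have "poly p z - poly q z * E z = (\<Prod>k\<in>K. z - a k) * v z" for z
    unfolding v(2)[symmetric]
    by (simp add: sum.Plus p_def q_def f_def poly_sum poly_monom sum_negf sum_distrib_right mult.assoc)
  ultimately show ?thesis
    using coeff_p coeff_q v(1) by (intro exI[of _ p] exI[of _ q]) (auto intro: hermite_interpI)
qed

text \<open>
  The quotient of \<open>p\<close> by the product of the node factors is entire and, by the degrees, tends
  to 0 at infinity, hence vanishes by Liouville's theorem.
\<close>
lemma poly_divisible_by_nodes_eq_0: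
  assumes "v holomorphic_on UNIV" and "\<And>z. poly p z = (\<Prod>k\<in>K. z - a k) * v z"
    and "finite K" and "degree p < card K"
  shows "p = (0 :: complex poly)"
proof -
  define D where "D = (\<Prod>k\<in>K. [:- a k, 1:])"
  have "degree D = card K"
    unfolding D_def by (subst degree_prod_sum_eq) auto
  then have *: "((\<lambda>z. poly p z / poly D z) \<longlongrightarrow> 0) at_infinity"
    using assms(4) by (intro poly_divide_tendsto_0_at_infinity) auto
  have D: "poly D z = (\<Prod>k\<in>K. z - a k)" for z
    by (simp add: D_def poly_prod)
  have "D \<noteq> 0"
    using assms(3) by (simp add: D_def)
  then obtain B where B: "\<And>z. poly D z = 0 \<Longrightarrow> norm z \<le> B"
    using finite_imp_bounded[OF poly_roots_finite[of D]] by (auto simp: bounded_iff)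
  have "eventually (\<lambda>z. poly D z \<noteq> 0) at_infinity"
    unfolding eventually_at_infinity using B by (intro exI[of _ "B + 1"]) force
  then have "eventually (\<lambda>z. poly p z / poly D z = v z) at_infinity"
    by eventually_elim (simp add: assms(2) D)
  then have "(v \<longlongrightarrow> 0) at_infinity"
    using * by (rule Lim_transform_eventually[rotated])
  then have "v z = 0" for z
    by (rule Liouville_weak_0[OF assms(1)])
  then show ?thesis
    using assms(2) by (simp add: poly_all_0_iff_0[symmetric])
qed

text \<open>
  The combination \<open>(p\<^sub>1 - q\<^sub>1 E) q\<^sub>2 - (p\<^sub>2 - q\<^sub>2 E) q\<^sub>1\<close> is free of \<open>E\<close>, so it is a
  polynomial that has more zeros than its degree allows.
\<close>
lemma hermite_interp_cross_mult:
  assumes "hermite_interp E K a p1 q1" "hermite_interp E K a p2 q2"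
    and "finite K" "degree p1 + degree q2 < card K" "degree p2 + degree q1 < card K"
  shows "p1 * q2 = p2 * q1"
proof -
  obtain v1 where v1: "v1 holomorphic_on UNIV"
      "\<And>z. poly p1 z - poly q1 z * E z = (\<Prod>k\<in>K. z - a k) * v1 z"
    using assms(1) by (rule hermite_interpE) (rule that)
  obtain v2 where v2: "v2 holomorphic_on UNIV"
      "\<And>z. poly p2 z - poly q2 z * E z = (\<Prod>k\<in>K. z - a k) * v2 z"
    using assms(2) by (rule hermite_interpE) (rule that)
  have "p1 * q2 - p2 * q1 = 0"
  proof (rule poly_divisible_by_nodes_eq_0[OF _ _ \<open>finite K\<close>])
    show "(\<lambda>z. v1 z * poly q2 z - v2 z * poly q1 z) holomorphic_on UNIV"
      using v1 v2 by (intro holomorphic_intros) auto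
    fix z
    have "poly (p1 * q2 - p2 * q1) z = (poly p1 z - poly q1 z * E z) * poly q2 z -
        (poly p2 z - poly q2 z * E z) * poly q1 z"
      by (simp add: algebra_simps)
    also have "\<dots> = (\<Prod>k\<in>K. z - a k) * (v1 z * poly q2 z - v2 z * poly q1 z)"
      unfolding v1(2) v2(2) by (simp add: algebra_simps)
    finally show "poly (p1 * q2 - p2 * q1) z =
        (\<Prod>k\<in>K. z - a k) * (v1 z * poly q2 z - v2 z * poly q1 z)" .
  next
    have "degree (p1 * q2 - p2 * q1) \<le> max (degree p1 + degree q2) (degree p2 + degree q1)"
      by (meson degree_diff_le_max degree_mult_le max.mono order_trans)
    then show "degree (p1 * q2 - p2 * q1) < card K"
      using assms(4,5) by linarith
  qed
  then show ?thesis
    by simp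
qed

lemma hermite_interp_denominator_nonzero:
  assumes "hermite_interp E K a p q" "p \<noteq> 0 \<or> q \<noteq> 0" "finite K" "degree p < card K"
  shows "q \<noteq> 0"
proof
  assume "q = 0"
  moreover obtain v where "v holomorphic_on UNIV"
      "\<And>z. poly p z - poly q z * E z = (\<Prod>k\<in>K. z - a k) * v z"
    using assms(1) by (rule hermite_interpE) (rule that)
  ultimately have "p = 0"
    using poly_divisible_by_nodes_eq_0[of v p a K] assms(3,4) by simp
  with \<open>q = 0\<close> assms(2) show False
    by simp
qed

text \<open>
  If the cancelled root is a node, that node is used up by the cancellation. If it is not, then all
  nodes survive, and any one of them can be dropped.
\<close>
lemma hermite_interp_cancel_root:
  assumes "hermite_interp E K a ([:-b, 1:] * p) ([:-b, 1:] * q)"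
    and E: "E holomorphic_on UNIV" and K: "finite K" "K \<noteq> {}"
  obtains j where "j \<in> K" "hermite_interp E (K - {j}) a p q"
proof -
  obtain v where v: "v holomorphic_on UNIV"
      "\<And>z. poly ([:-b, 1:] * p) z - poly ([:-b, 1:] * q) z * E z = (\<Prod>k\<in>K. z - a k) * v z"
    using assms(1) by (rule hermite_interpE) (rule that)
  have eq: "(z - b) * (poly p z - poly q z * E z) = (\<Prod>k\<in>K. z - a k) * v z" for z
    using v(2)[of z] by (simp add: algebra_simps)
  have "\<exists>j\<in>K. \<exists>w. w holomorphic_on UNIV \<and>
    (\<forall>z. (\<Prod>k\<in>K. z - a k) * v z = (z - b) * ((\<Prod>k\<in>K - {j}. z - a k) * w z))"
  proof (cases "\<exists>j\<in>K. a j = b")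
    case True
    then obtain j where j: "j \<in> K" "a j = b"
      by blast
    have "(\<Prod>k\<in>K. z - a k) = (z - b) * (\<Prod>k\<in>K - {j}. z - a k)" for z
      using K j by (subst prod.remove[of _ j]) auto
    then show ?thesis
      using j v(1) by (intro bexI[of _ j] exI[of _ v]) auto
  next
    case False
    then have "(\<Prod>k\<in>K. b - a k) \<noteq> 0"
      using K by auto
    then have "v b = 0"
      using eq[of b] by auto
    then obtain g where g: "g holomorphic_on UNIV" "\<And>z. v z = (z - b) * g z"
      using entire_divide_root[OF v(1)] by blast
    obtain j where j: "j \<in> K"
      using K by blast
    have "(\<Prod>k\<in>K. z - a k) = (z - a j) * (\<Prod>k\<in>K - {j}. z - a k)" for z
      using K j by (subst prod.remove[of _ j]) auto
    then show ?thesis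
      using j g by (intro bexI[of _ j] exI[of _ "\<lambda>z. (z - a j) * g z"])
        (auto intro!: holomorphic_intros simp: mult_ac)
  qed
  then obtain j w where j: "j \<in> K" and w: "w holomorphic_on UNIV"
      "\<And>z. (\<Prod>k\<in>K. z - a k) * v z = (z - b) * ((\<Prod>k\<in>K - {j}. z - a k) * w z)"
    by blast
  have "poly p z - poly q z * E z = (\<Prod>k\<in>K - {j}. z - a k) * w z" for z
    by (rule entire_eq_of_eq_off_point[where a = b])
      (use E w eq in \<open>auto intro!: holomorphic_intros\<close>)
  with j w(1) show ?thesis
    by (intro that hermite_interpI)
qed

section \<open>Nodes that run into the origin\<close>

lemma poly_eq_sum_below:
  fixes p :: "complex poly"
  assumes "\<And>i. m \<le> i \<Longrightarrow> coeff p i = 0"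
  shows "poly p z = (\<Sum>i<m. coeff p i * z ^ i)"
proof (cases "p = 0")
  case False
  then have "degree p < m"
    using assms degree_less_if_coeffs_vanish by blast
  then show ?thesis
    unfolding poly_altdef
    by (intro sum.mono_neutral_left) (auto simp: coeff_eq_0)
qed auto

text \<open>
  Differentiating \<open>p - q exp\<close> lowers the order of its zero at 0 by one, lowers the degree of
  \<open>p\<close>, and turns \<open>q\<close> into \<open>q + q'\<close>, which has the degree of \<open>q\<close>. After \<open>m\<close> steps only
  \<open>q exp\<close> is left, whose order at 0 is that of \<open>q\<close>.
\<close>
lemma pade_order_bound:
  assumes "\<And>i. m \<le> i \<Longrightarrow> coeff p i = 0" and "\<And>i. l \<le> i \<Longrightarrow> coeff q i = 0"
    and "hermite_interp exp {..<m + l} (\<lambda>_. 0) p q"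
  shows "p = 0 \<and> q = 0"
proof -
  obtain v where "v holomorphic_on UNIV" "\<And>z. poly p z - poly q z * exp z = z ^ (m + l) * v z"
    using assms(3) unfolding hermite_interp_def by auto
  with assms(1,2) show ?thesis
  proof (induction m arbitrary: p q v)
    case 0
    then have p: "p = 0"
      by (intro poly_eqI) auto
    have "poly q z = (\<Prod>k\<in>{..<l}. z - 0) * (- v z * exp (- z))" for z
      using 0(4)[of z] by (simp add: p exp_minus field_simps) (metis minus_minus mult_minus_left)
    moreover have "(\<lambda>z. - v z * exp (- z)) holomorphic_on UNIV"
      using 0(3) by (intro holomorphic_intros)
    ultimately have "q = 0" if "degree q < l"
      using poly_divisible_by_nodes_eq_0[of _ q "\<lambda>_. 0" "{..<l}"] that by simp
    then show ?case
      using p degree_less_if_coeffs_vanish 0(2) by blast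
  next
    case (Suc m)
    define w where "w z = of_nat (Suc (m + l)) * v z + z * deriv v z" for z
    have w: "w holomorphic_on UNIV"
      unfolding w_def using Suc.prems(3) by (intro holomorphic_intros) auto
    have "poly (pderiv p) z - poly (q + pderiv q) z * exp z = z ^ (m + l) * w z" for z
    proof -
      have "((\<lambda>z. poly p z - poly q z * exp z) has_field_derivative
          (poly (pderiv p) z - poly (q + pderiv q) z * exp z)) (at z)"
        by (auto intro!: derivative_eq_intros simp: algebra_simps)
      moreover have "(v has_field_derivative deriv v z) (at z)"
        using Suc.prems(3) holomorphic_derivI[OF _ open_UNIV] by blast
      from DERIV_mult[OF DERIV_power[OF DERIV_ident, of "Suc (m + l)"] this]
      have "((\<lambda>z. z ^ (Suc m + l) * v z) has_field_derivative z ^ (m + l) * w z) (at z)"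
        by (simp add: w_def algebra_simps)
      ultimately show ?thesis
        using Suc.prems(4) DERIV_unique by (metis (no_types, lifting) ext)
    qed
    moreover have "coeff (pderiv p) i = 0" if "m \<le> i" for i
      using Suc.prems(1)[of "Suc i"] that by (simp add: coeff_pderiv)
    moreover have "coeff (q + pderiv q) i = 0" if "l \<le> i" for i
      using Suc.prems(2)[of i] Suc.prems(2)[of "Suc i"] that by (simp add: coeff_pderiv)
    ultimately have IH: "pderiv p = 0" "q + pderiv q = 0"
      using Suc.IH[of "pderiv p" "q + pderiv q" w] w by auto
    have "degree q = degree q - 1"
      using IH(2) by (metis degree_minus degree_pderiv eq_neg_iff_add_eq_0)
    then have "pderiv q = 0"
      by (simp add: pderiv_eq_0_iff)
    with IH(2) have q: "q = 0"
      by simp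
    obtain c where c: "p = [:c:]"
      using IH(1) by (metis degree_eq_zeroE pderiv_eq_0_iff)
    then show ?case
      using Suc.prems(4)[of 0] q by simp
  qed
qed

lemma entire_divide_power:
  fixes F :: "complex \<Rightarrow> complex"
  assumes F: "F holomorphic_on UNIV" and bd: "\<forall>\<^sub>F z in at 0. norm (F z) \<le> C * norm z ^ N"
  obtains v where "v holomorphic_on UNIV" "\<And>z. F z = z ^ N * v z"
proof -
  have "(\<lambda>z. F z / z ^ N) holomorphic_on UNIV - {0}"
    using F by (intro holomorphic_intros) (auto intro: holomorphic_on_subset)
  moreover have "\<forall>\<^sub>F z in at 0. norm (F z / z ^ N) \<le> C"
    using bd eventually_neq_at_within[of 0 0 UNIV]
    by eventually_elim (simp add: norm_divide norm_power divide_simps)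
  ultimately obtain g where g: "g holomorphic_on UNIV" "\<And>z. z \<noteq> 0 \<Longrightarrow> g z = F z / z ^ N"
    using holomorphic_on_extend_bounded[of "\<lambda>z. F z / z ^ N" UNIV 0] by auto
  have "F z = z ^ N * g z" for z
    by (rule entire_eq_of_eq_off_point[where a = 0]) (use F g in \<open>auto intro!: holomorphic_intros\<close>)
  with g(1) show ?thesis
    by (rule that)
qed

lemma common_convergent_subsequence:
  fixes c :: "nat \<Rightarrow> 'i \<Rightarrow> complex"
  assumes "finite I" and "\<And>i. i \<in> I \<Longrightarrow> bounded (range (\<lambda>k. c k i))"
  shows "\<exists>r :: nat \<Rightarrow> nat. strict_mono r \<and> (\<forall>i\<in>I. convergent (\<lambda>k. c (r k) i))"
  using assms
proof (induction I rule: finite_induct)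
  case empty
  then show ?case
    by (auto intro: strict_mono_id)
next
  case (insert i I)
  then obtain r :: "nat \<Rightarrow> nat" where r: "strict_mono r" "\<And>j. j \<in> I \<Longrightarrow> convergent (\<lambda>k. c (r k) j)"
    by auto
  have "bounded (range (\<lambda>k. c (r k) i))"
    by (rule bounded_subset[OF insert.prems[of i]]) auto
  then obtain L s where s: "strict_mono (s :: nat \<Rightarrow> nat)" "(\<lambda>k. c (r (s k)) i) \<longlonglongrightarrow> L"
    using bounded_imp_convergent_subsequence[of "\<lambda>k. c (r k) i"] by (auto simp: o_def)
  have "convergent (\<lambda>k. c (r (s k)) j)" if "j \<in> insert i I" for j
    using that s(2) convergent_subseq_convergent[OF r(2) s(1)]
    by (auto simp: o_def convergent_def)
  then show ?case
    using strict_mono_o[OF r(1) s(1)] unfolding o_def by blast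
qed

text \<open>
  On the unit circle every node factor has modulus at least 1/2, which bounds the cofactor \<open>v\<close>
  there, and by the maximum modulus principle in the whole disc. The bound does not depend on the
  position of the nodes, and so it survives when they run into 0.
\<close>
lemma norm_remainder_le:
  fixes a :: "'k \<Rightarrow> complex"
  assumes K: "finite K" "card K = N" and d: "0 \<le> d" "d \<le> 1/2" and a: "\<And>k. k \<in> K \<Longrightarrow> norm (a k) \<le> d"
    and v: "v holomorphic_on UNIV" and f: "\<And>z. f z = (\<Prod>k\<in>K. z - a k) * v z"
    and M: "\<And>z. norm z \<le> 1 \<Longrightarrow> norm (f z) \<le> M" and z: "norm z \<le> 1"
  shows "norm (f z) \<le> 2 ^ N * M * (norm z + d) ^ N"
proof -
  have "norm (v w) \<le> 2 ^ N * M" if "w \<in> cball 0 1" for w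
  proof (rule maximum_modulus_frontier[OF _ _ _ _ that])
    show "v holomorphic_on interior (cball 0 1)"
      using v holomorphic_on_subset by blast
    then show "continuous_on (closure (cball 0 1)) v"
      using v holomorphic_on_imp_continuous_on holomorphic_on_subset by blast
    fix u :: complex assume "u \<in> frontier (cball 0 1)"
    then have u: "norm u = 1"
      by (simp add: frontier_cball)
    have "(1/2) ^ N = (\<Prod>k\<in>K. 1/2 :: real)"
      using K by simp
    also have "\<dots> \<le> (\<Prod>k\<in>K. norm (u - a k))"
    proof (rule prod_mono)
      fix k assume "k \<in> K"
      then show "0 \<le> (1/2::real) \<and> 1/2 \<le> norm (u - a k)"
        using a[of k] d u norm_triangle_ineq2[of u "a k"] by simp
    qed
    finally have "(1/2) ^ N * norm (v u) \<le> norm (f u)"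
      by (simp add: f norm_mult prod_norm mult_right_mono)
    also have "\<dots> \<le> M"
      using M u by simp
    finally show "norm (v u) \<le> 2 ^ N * M"
      by (simp add: power_one_over field_simps)
  qed auto
  then have v_le: "norm (v z) \<le> 2 ^ N * M"
    using z by simp
  have "norm (\<Prod>k\<in>K. z - a k) \<le> (\<Prod>k\<in>K. norm z + d)"
    unfolding prod_norm[symmetric]
  proof (intro prod_mono conjI norm_ge_zero)
    fix k assume "k \<in> K"
    then show "norm (z - a k) \<le> norm z + d"
      using a[of k] norm_triangle_ineq4[of z "a k"] by linarith
  qed
  then have "norm (\<Prod>k\<in>K. z - a k) \<le> (norm z + d) ^ N"
    using K by simp
  then have "norm (f z) \<le> (norm z + d) ^ N * (2 ^ N * M)"
    unfolding f norm_mult using v_le d by (intro mult_mono) auto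
  then show ?thesis
    by (simp add: mult_ac)
qed

text \<open>
  The compactness argument. The pairs are scaled to have coefficients of total modulus 1, so that a
  subsequence converges to a pair which is not zero. A bound for the remainders by
  \<open>C (\<bar>z\<bar> + d)\<^sup>N\<close>, in which \<open>C\<close> does not depend on the nodes, becomes \<open>C \<bar>z\<bar>\<^sup>N\<close>
  in the limit: the \<open>N\<close> nodes have merged into a zero of order \<open>N\<close> at 0.
\<close>
lemma small_nodes_limit:
  fixes K :: "nat \<Rightarrow> 'k set" and p q :: "nat \<Rightarrow> complex poly"
  assumes K: "\<And>k. finite (K k)" "\<And>k. card (K k) = N"
    and a: "\<And>k j. j \<in> K k \<Longrightarrow> norm (a k j) \<le> d k" and d: "\<And>k. 0 \<le> d k" "d \<longlonglongrightarrow> 0"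
    and nz: "\<And>k. p k \<noteq> 0 \<or> q k \<noteq> 0"
    and p: "\<And>k i. m \<le> i \<Longrightarrow> coeff (p k) i = 0" and q: "\<And>k i. l \<le> i \<Longrightarrow> coeff (q k) i = 0"
    and interp: "\<And>k. hermite_interp exp (K k) (a k) (p k) (q k)"
  shows "\<exists>r c P Q. strict_mono (r :: nat \<Rightarrow> nat) \<and>
    (\<forall>i. (\<lambda>k. c k * coeff (p (r k)) i) \<longlonglongrightarrow> coeff P i) \<and>
    (\<forall>i. (\<lambda>k. c k * coeff (q (r k)) i) \<longlonglongrightarrow> coeff Q i) \<and>
    (P \<noteq> 0 \<or> Q \<noteq> 0) \<and> (\<forall>i\<ge>m. coeff P i = 0) \<and> (\<forall>i\<ge>l. coeff Q i = 0) \<and>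
    hermite_interp exp {..<N} (\<lambda>_. 0) P Q"
proof -
  define s where "s k = (\<Sum>i<m. norm (coeff (p k) i)) + (\<Sum>i<l. norm (coeff (q k) i))" for k
  have s_ge: "norm (coeff (p k) i) \<le> s k" "norm (coeff (q k) i) \<le> s k" for k i
  proof -
    have "norm (coeff (p k) i) \<le> (\<Sum>i<m. norm (coeff (p k) i))"
      by (cases "i < m") (auto intro!: member_le_sum sum_nonneg simp: p)
    moreover have "norm (coeff (q k) i) \<le> (\<Sum>i<l. norm (coeff (q k) i))"
      by (cases "i < l") (auto intro!: member_le_sum sum_nonneg simp: q)
    moreover have "0 \<le> (\<Sum>i<m. norm (coeff (p k) i))" "0 \<le> (\<Sum>i<l. norm (coeff (q k) i))"
      by (simp_all add: sum_nonneg)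
    ultimately show "norm (coeff (p k) i) \<le> s k" "norm (coeff (q k) i) \<le> s k"
      by (simp_all add: s_def)
  qed
  have s_pos: "0 < s k" for k
  proof -
    obtain i where "coeff (p k) i \<noteq> 0 \<or> coeff (q k) i \<noteq> 0"
      using nz[of k] by (metis leading_coeff_0_iff)
    then show ?thesis
      using s_ge[of k i] by (metis norm_le_zero_iff not_le order_trans)
  qed
  define p' where "p' k = smult (of_real (1 / s k)) (p k)" for k
  define q' where "q' k = smult (of_real (1 / s k)) (q k)" for k
  have p': "coeff (p' k) i = 0" if "m \<le> i" for k i
    using p that by (simp add: p'_def)
  have q': "coeff (q' k) i = 0" if "l \<le> i" for k i
    using q that by (simp add: q'_def)
  have norm1: "(\<Sum>i<m. norm (coeff (p' k) i)) + (\<Sum>i<l. norm (coeff (q' k) i)) = 1" for k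
    using s_pos[of k] unfolding p'_def q'_def
    by (simp add: norm_mult norm_divide sum_divide_distrib[symmetric] add_divide_distrib[symmetric] s_def[symmetric])
  have "norm (coeff (p' k) i) \<le> 1" "norm (coeff (q' k) i) \<le> 1" for k i
    using s_ge[of k i] s_pos[of k] by (simp_all add: p'_def q'_def norm_mult norm_divide)
  then have bnd: "bounded (range (\<lambda>k. case_sum (coeff (p' k)) (coeff (q' k)) t))" for t
    by (cases t) (auto simp: bounded_iff intro!: exI[of _ 1])
  obtain r :: "nat \<Rightarrow> nat" where r: "strict_mono r"
    and conv: "\<And>t. t \<in> {..<m} <+> {..<l} \<Longrightarrow>
      convergent (\<lambda>k. case_sum (coeff (p' (r k))) (coeff (q' (r k))) t)"
    using common_convergent_subsequence[of "{..<m} <+> {..<l}"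
        "\<lambda>k. case_sum (coeff (p' k)) (coeff (q' k))"] bnd by auto
  define P where "P = (\<Sum>i<m. monom (lim (\<lambda>k. coeff (p' (r k)) i)) i)"
  define Q where "Q = (\<Sum>i<l. monom (lim (\<lambda>k. coeff (q' (r k)) i)) i)"
  have P: "coeff P i = 0" if "m \<le> i" for i
    using that by (simp add: P_def coeff_sum)
  have Q: "coeff Q i = 0" if "l \<le> i" for i
    using that by (simp add: Q_def coeff_sum)
  have limP: "(\<lambda>k. coeff (p' (r k)) i) \<longlonglongrightarrow> coeff P i" for i
    using conv[of "Inl i"] p'[of i] by (cases "i < m") (auto simp: P_def coeff_sum convergent_LIMSEQ_iff)
  have limQ: "(\<lambda>k. coeff (q' (r k)) i) \<longlonglongrightarrow> coeff Q i" for i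
    using conv[of "Inr i"] q'[of i] by (cases "i < l") (auto simp: Q_def coeff_sum convergent_LIMSEQ_iff)
  have "(\<lambda>k. (\<Sum>i<m. norm (coeff (p' (r k)) i)) + (\<Sum>i<l. norm (coeff (q' (r k)) i))) \<longlonglongrightarrow>
      (\<Sum>i<m. norm (coeff P i)) + (\<Sum>i<l. norm (coeff Q i))"
    by (intro tendsto_intros limP limQ)
  then have "(\<Sum>i<m. norm (coeff P i)) + (\<Sum>i<l. norm (coeff Q i)) = 1"
    by (simp add: norm1 LIMSEQ_const_iff)
  then have PQ: "P \<noteq> 0 \<or> Q \<noteq> 0"
    by auto
  define f where "f k z = poly (p' k) z - poly (q' k) z * exp z" for k z
  define F where "F z = poly P z - poly Q z * exp z" for z
  have f_lim: "(\<lambda>k. f (r k) z) \<longlonglongrightarrow> F z" for z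
  proof -
    have "poly (p' k) z = (\<Sum>i<m. coeff (p' k) i * z ^ i)" "poly P z = (\<Sum>i<m. coeff P i * z ^ i)"
      "poly (q' k) z = (\<Sum>i<l. coeff (q' k) i * z ^ i)" "poly Q z = (\<Sum>i<l. coeff Q i * z ^ i)" for k
      by (intro poly_eq_sum_below p' q' P Q; assumption)+
    then show ?thesis
      unfolding f_def F_def by (simp only:) (intro tendsto_intros limP limQ)
  qed
  have f_le: "norm (f k z) \<le> 1 + exp 1" if "norm z \<le> 1" for k z
  proof -
    have le: "norm (poly g z) \<le> 1"
      if "\<And>i. b \<le> i \<Longrightarrow> coeff g i = 0" "(\<Sum>i<b. norm (coeff g i)) \<le> 1" for g b
    proof -
      have "norm (poly g z) \<le> (\<Sum>i<b. norm (coeff g i * z ^ i))"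
        using poly_eq_sum_below[of b g z] that(1) by (simp add: norm_sum)
      also have "\<dots> \<le> (\<Sum>i<b. norm (coeff g i))"
        using \<open>norm z \<le> 1\<close> by (intro sum_mono) (simp add: norm_mult norm_power mult_left_le power_le_one)
      finally show ?thesis
        using that(2) by linarith
    qed
    have "norm (poly (p' k) z) \<le> 1"
      by (rule le[where b = m]) (use p' norm1[of k] sum_nonneg[of "{..<l}" "\<lambda>i. norm (coeff (q' k) i)"] in auto)
    moreover have "norm (poly (q' k) z) \<le> 1"
      by (rule le[where b = l]) (use q' norm1[of k] sum_nonneg[of "{..<m}" "\<lambda>i. norm (coeff (p' k) i)"] in auto)
    moreover have "norm (exp z) \<le> exp 1"
      using that norm_exp[of z] by (meson exp_le_cancel_iff order_trans)
    ultimately have "norm (poly (q' k) z * exp z) \<le> 1 * exp 1"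
      unfolding norm_mult by (intro mult_mono) auto
    then show ?thesis
      unfolding f_def using \<open>norm (poly (p' k) z) \<le> 1\<close> norm_triangle_ineq4[of "poly (p' k) z" "poly (q' k) z * exp z"]
      by linarith
  qed
  define C where "C = 2 ^ N * (1 + exp 1 :: real)"
  have dr: "(\<lambda>k. d (r k)) \<longlonglongrightarrow> 0"
    using LIMSEQ_subseq_LIMSEQ[OF d(2) r] by (simp add: o_def)
  have "norm (F z) \<le> C * norm z ^ N" if z: "norm z \<le> 1" for z
  proof (rule tendsto_le)
    show "(\<lambda>k. norm (f (r k) z)) \<longlonglongrightarrow> norm (F z)"
      by (intro tendsto_intros f_lim)
    have "(\<lambda>k. C * (norm z + d (r k)) ^ N) \<longlonglongrightarrow> C * (norm z + 0) ^ N"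
      by (intro tendsto_intros dr)
    then show "(\<lambda>k. C * (norm z + d (r k)) ^ N) \<longlonglongrightarrow> C * norm z ^ N"
      by simp
    have "\<forall>\<^sub>F k in sequentially. d (r k) < 1/2"
      using order_tendstoD(2)[OF dr, of "1/2"] by simp
    then show "\<forall>\<^sub>F k in sequentially. norm (f (r k) z) \<le> C * (norm z + d (r k)) ^ N"
    proof eventually_elim
      case (elim k)
      have "hermite_interp exp (K (r k)) (a (r k)) (p' (r k)) (q' (r k))"
        unfolding p'_def q'_def by (intro hermite_interp_smult interp)
      then obtain v where v: "v holomorphic_on UNIV" "\<And>z. f (r k) z = (\<Prod>j\<in>K (r k). z - a (r k) j) * v z"
        by (rule hermite_interpE) (rule that, assumption, simp only: f_def)
      show ?case
        unfolding C_def
      proof (rule norm_remainder_le[where K = "K (r k)" and a = "a (r k)" and v = v])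
        show "d (r k) \<le> 1/2"
          using elim by simp
      qed (fact K d(1) a v f_le z)+
    qed
  qed simp
  then have "\<forall>\<^sub>F z in at 0. norm (F z) \<le> C * norm z ^ N"
    unfolding eventually_at by (intro exI[of _ 1]) auto
  moreover have "F holomorphic_on UNIV"
    unfolding F_def by (intro holomorphic_intros)
  ultimately obtain v where v: "v holomorphic_on UNIV" "\<And>z. F z = z ^ N * v z"
    using entire_divide_power by blast
  have "hermite_interp exp {..<N} (\<lambda>_. 0) P Q"
    by (rule hermite_interpI[OF v(1)]) (simp add: v(2)[unfolded F_def])
  moreover have "(\<lambda>k. of_real (1 / s (r k)) * coeff (p (r k)) i) \<longlonglongrightarrow> coeff P i"
    "(\<lambda>k. of_real (1 / s (r k)) * coeff (q (r k)) i) \<longlonglongrightarrow> coeff Q i" for i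
    using limP[of i] limQ[of i] by (simp_all add: p'_def q'_def)
  ultimately show ?thesis
    using r PQ P Q
    by (intro exI[of _ r] exI[of _ "\<lambda>k. of_real (1 / s (r k))"] exI[of _ P] exI[of _ Q] conjI allI impI)
qed

section \<open>Interpolants with small nodes\<close>

lemma coprime_iff_no_common_root:
  fixes p q :: "complex poly"
  assumes "q \<noteq> 0"
  shows "coprime p q \<longleftrightarrow> (\<forall>z. poly p z \<noteq> 0 \<or> poly q z \<noteq> 0)"
proof
  assume no_root: "\<forall>z. poly p z \<noteq> 0 \<or> poly q z \<noteq> 0"
  have "degree (gcd p q) = 0"
  proof (rule ccontr)
    assume "degree (gcd p q) \<noteq> 0"
    then obtain z where "poly (gcd p q) z = 0"
      using alg_closed_imp_poly_has_root by blast
    then have "[:-z, 1:] dvd p" "[:-z, 1:] dvd q"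
      by (meson dvd_trans gcd_dvd1 gcd_dvd2 poly_eq_0_iff_dvd)+
    then show False
      using no_root by (simp add: poly_eq_0_iff_dvd)
  qed
  moreover have "gcd p q \<noteq> 0"
    using assms by simp
  ultimately show "coprime p q"
    using coprime_iff_gcd_eq_1 is_unit_gcd is_unit_iff_degree by blast
next
  assume "coprime p q"
  then show "\<forall>z. poly p z \<noteq> 0 \<or> poly q z \<noteq> 0"
    using coprime_poly_0 by metis
qed

text \<open>
  At a single node 0 this is the order bound above. A sequence of counterexamples whose nodes shrink
  to 0 would have a nonzero limit pair that violates it. The radius is uniform in the node set,
  since the lemma is applied later to a set from which an unspecified node has been removed.
\<close>
lemma small_nodes_normal:
  shows "\<exists>\<delta>>0. \<forall>(K :: 'k set) a p q. finite K \<longrightarrow> card K = m + l \<longrightarrow> (\<forall>j\<in>K. norm (a j) \<le> \<delta>) \<longrightarrow>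
    (\<forall>i\<ge>m. coeff p i = 0) \<longrightarrow> (\<forall>i\<ge>l. coeff q i = 0) \<longrightarrow> hermite_interp exp K a p q \<longrightarrow> p = 0 \<and> q = 0"
proof (rule ccontr)
  assume neg: "\<not> ?thesis"
  have "\<exists>(K :: 'k set) a p q. finite K \<and> card K = m + l \<and> (\<forall>j\<in>K. norm (a j) \<le> inverse (real (Suc k))) \<and>
    (\<forall>i\<ge>m. coeff p i = 0) \<and> (\<forall>i\<ge>l. coeff q i = 0) \<and> hermite_interp exp K a p q \<and> (p \<noteq> 0 \<or> q \<noteq> 0)" for k
    using neg[unfolded not_ex, THEN spec, of "inverse (real (Suc k))"] by (simp del: of_nat_Suc)
  then obtain K :: "nat \<Rightarrow> 'k set" and a p q where
    H: "\<And>k. finite (K k)" "\<And>k. card (K k) = m + l" "\<And>k j. j \<in> K k \<Longrightarrow> norm (a k j) \<le> inverse (real (Suc k))"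
      "\<And>k. p k \<noteq> 0 \<or> q k \<noteq> 0" "\<And>k i. m \<le> i \<Longrightarrow> coeff (p k) i = 0" "\<And>k i. l \<le> i \<Longrightarrow> coeff (q k) i = 0"
      "\<And>k. hermite_interp exp (K k) (a k) (p k) (q k)"
    by metis
  have "\<exists>r c P Q. strict_mono (r :: nat \<Rightarrow> nat) \<and>
    (\<forall>i. (\<lambda>k. c k * coeff (p (r k)) i) \<longlonglongrightarrow> coeff P i) \<and>
    (\<forall>i. (\<lambda>k. c k * coeff (q (r k)) i) \<longlonglongrightarrow> coeff Q i) \<and>
    (P \<noteq> 0 \<or> Q \<noteq> 0) \<and> (\<forall>i\<ge>m. coeff P i = 0) \<and> (\<forall>i\<ge>l. coeff Q i = 0) \<and>
    hermite_interp exp {..<m + l} (\<lambda>_. 0) P Q"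
  proof (rule small_nodes_limit[where K = K and d = "\<lambda>k. inverse (real (Suc k))"])
    show "0 \<le> inverse (real (Suc k))" for k
      by simp
  qed (fact H LIMSEQ_inverse_real_of_nat)+
  then show False
    using pade_order_bound[of m _ l] by blast
qed

text \<open>
  Normality is used twice. A denominator of degree less than \<open>n\<close> leaves \<open>2n+1\<close> coefficients
  for \<open>2n+1\<close> nodes. A common root can be cancelled at the cost of at most one node, which leaves
  \<open>2n\<close> coefficients for \<open>2n\<close> nodes.
\<close>
lemma small_nodes_degree_coprime:
  shows "\<exists>\<delta>>0. \<forall>(K :: 'k set) a p q. finite K \<longrightarrow> card K = 2 * n + 1 \<longrightarrow> (\<forall>j\<in>K. norm (a j) \<le> \<delta>) \<longrightarrow>
    degree p \<le> n \<longrightarrow> degree q \<le> n \<longrightarrow> p \<noteq> 0 \<or> q \<noteq> 0 \<longrightarrow> hermite_interp exp K a p q \<longrightarrow>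
    degree q = n \<and> coprime p q"
proof -
  obtain \<delta>1 where \<delta>1: "\<delta>1 > 0" "\<And>(K :: 'k set) a p q. \<lbrakk>finite K; card K = Suc n + n; \<forall>j\<in>K. norm (a j) \<le> \<delta>1;
      \<forall>i\<ge>Suc n. coeff p i = 0; \<forall>i\<ge>n. coeff q i = 0; hermite_interp exp K a p q\<rbrakk> \<Longrightarrow> p = 0 \<and> q = 0"
    using small_nodes_normal[of "Suc n" n] by metis
  obtain \<delta>2 where \<delta>2: "\<delta>2 > 0" "\<And>(K :: 'k set) a p q. \<lbrakk>finite K; card K = n + n; \<forall>j\<in>K. norm (a j) \<le> \<delta>2;
      \<forall>i\<ge>n. coeff p i = 0; \<forall>i\<ge>n. coeff q i = 0; hermite_interp exp K a p q\<rbrakk> \<Longrightarrow> p = 0 \<and> q = 0"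
    using small_nodes_normal[of n n] by metis
  have "degree q = n \<and> coprime p q"
    if K: "finite K" "card K = 2 * n + 1" and a: "\<forall>j\<in>K. norm (a j) \<le> min \<delta>1 \<delta>2"
      and deg: "degree p \<le> n" "degree q \<le> n" and nz: "p \<noteq> 0 \<or> q \<noteq> 0"
      and interp: "hermite_interp exp K a p q" for K :: "'k set" and a p q
  proof
    show "degree q = n"
    proof (rule ccontr)
      assume "degree q \<noteq> n"
      then have "\<forall>i\<ge>n. coeff q i = 0" "\<forall>i\<ge>Suc n. coeff p i = 0"
        using deg by (auto intro!: coeff_eq_0)
      then show False
        using \<delta>1(2)[of K a p q] K a nz interp by auto
    qed
    have "q \<noteq> 0"
      using hermite_interp_denominator_nonzero[OF interp nz] K deg by simp
    show "coprime p q"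
    proof (subst coprime_iff_no_common_root[OF \<open>q \<noteq> 0\<close>], rule ccontr)
      assume "\<not> (\<forall>z. poly p z \<noteq> 0 \<or> poly q z \<noteq> 0)"
      then obtain b where "poly p b = 0" "poly q b = 0"
        by blast
      then obtain p1 q1 where pq1: "p = [:-b, 1:] * p1" "q = [:-b, 1:] * q1"
        by (metis dvdE poly_eq_0_iff_dvd)
      have "K \<noteq> {}"
        using K by auto
      then obtain j where j: "j \<in> K" "hermite_interp exp (K - {j}) a p1 q1"
        using hermite_interp_cancel_root[of exp K a b p1 q1] interp K pq1
        by (metis holomorphic_on_exp)
      have low: "\<forall>i\<ge>n. coeff f i = 0" if "degree ([:-b, 1:] * f) \<le> n" for f
      proof (cases "f = 0")
        case False
        then have "degree ([:-b, 1:] * f) = Suc (degree f)"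
          by (subst degree_mult_eq) auto
        then show ?thesis
          using that by (auto intro!: coeff_eq_0)
      qed auto
      have "p1 = 0 \<and> q1 = 0"
        using \<delta>2(2)[of "K - {j}" a p1 q1] j K a low deg pq1 by auto
      then show False
        using \<open>q \<noteq> 0\<close> pq1 by simp
    qed
  qed
  then show ?thesis
    using \<delta>1(1) \<delta>2(1) by (intro exI[of _ "min \<delta>1 \<delta>2"]) auto
qed

definition monic_interp_pair ::
    "nat \<Rightarrow> 'k set \<Rightarrow> ('k \<Rightarrow> complex) \<Rightarrow> complex poly \<Rightarrow> complex poly \<Rightarrow> bool" where
  "monic_interp_pair n K a p q \<longleftrightarrow> degree p \<le> n \<and> degree q = n \<and> lead_coeff q = 1 \<and> coprime p q \<and>
     hermite_interp exp K a p q"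

lemma monic_interp_pair_exists:
  "\<exists>\<delta>>0. \<forall>(K :: 'k set) a. finite K \<longrightarrow> card K = 2 * n + 1 \<longrightarrow> (\<forall>j\<in>K. norm (a j) \<le> \<delta>) \<longrightarrow>
     (\<exists>p q. monic_interp_pair n K a p q)"
proof -
  obtain \<delta> where \<delta>: "\<delta> > 0" "\<And>(K :: 'k set) a p q. \<lbrakk>finite K; card K = 2 * n + 1; \<forall>j\<in>K. norm (a j) \<le> \<delta>;
      degree p \<le> n; degree q \<le> n; p \<noteq> 0 \<or> q \<noteq> 0; hermite_interp exp K a p q\<rbrakk> \<Longrightarrow>
      degree q = n \<and> coprime p q"
    using small_nodes_degree_coprime[of n] by metis
  have "\<exists>p q. monic_interp_pair n K a p q"
    if K: "finite K" "card K = 2 * n + 1" and a: "\<forall>j\<in>K. norm (a j) \<le> \<delta>" for K :: "'k set" and a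
  proof -
    obtain p q where pq: "p \<noteq> 0 \<or> q \<noteq> 0" "\<forall>i\<ge>Suc n. coeff p i = 0" "\<forall>i\<ge>Suc n. coeff q i = 0"
        "hermite_interp exp K a p q"
      using hermite_interp_exists[OF holomorphic_on_exp K(1), of "Suc n" "Suc n" a] K(2) by auto
    have deg: "degree p \<le> n" "degree q \<le> n"
      using pq(2,3) by (auto intro!: degree_le)
    have "q \<noteq> 0"
      using hermite_interp_denominator_nonzero[OF pq(4,1) K(1)] K deg by simp
    define c where "c = inverse (lead_coeff q)"
    have c: "c \<noteq> 0" "c * lead_coeff q = 1"
      using \<open>q \<noteq> 0\<close> by (auto simp: c_def)
    have "hermite_interp exp K a (smult c p) (smult c q)"
      by (rule hermite_interp_smult[OF pq(4)])
    then have "monic_interp_pair n K a (smult c p) (smult c q)"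
      using \<delta>(2)[OF K a, of "smult c p" "smult c q"] c deg \<open>q \<noteq> 0\<close>
      by (simp add: monic_interp_pair_def)
    then show ?thesis
      by blast
  qed
  then show ?thesis
    using \<delta>(1) by blast
qed

text \<open>
  A sequence of counterexamples would have a limit pair with a zero of order \<open>2n+1\<close> at 0, and
  such a pair is a constant multiple of the Pade pair. The constant is nonzero, and dividing by the
  leading coefficients, which converge to it, undoes the unknown scaling.
\<close>
lemma denominator_converges:
  assumes pade: "monic_interp_pair n {..<2 * n + 1} (\<lambda>_. 0) P0 Q0" and "\<epsilon> > 0"
  shows "\<exists>\<delta>>0. \<forall>(K :: 'k set) a p q. finite K \<longrightarrow> card K = 2 * n + 1 \<longrightarrow> (\<forall>j\<in>K. norm (a j) \<le> \<delta>) \<longrightarrow>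
    monic_interp_pair n K a p q \<longrightarrow> norm (coeff q i - coeff Q0 i) < \<epsilon>"
proof (rule ccontr)
  assume neg: "\<not> ?thesis"
  have "\<exists>(K :: 'k set) a p q. finite K \<and> card K = 2 * n + 1 \<and> (\<forall>j\<in>K. norm (a j) \<le> inverse (real (Suc k))) \<and>
    monic_interp_pair n K a p q \<and> \<not> norm (coeff q i - coeff Q0 i) < \<epsilon>" for k
    using neg[unfolded not_ex, THEN spec, of "inverse (real (Suc k))"] by (simp del: of_nat_Suc)
  then obtain K :: "nat \<Rightarrow> 'k set" and a p q where
    H: "\<And>k. finite (K k)" "\<And>k. card (K k) = 2 * n + 1"
      "\<And>k j. j \<in> K k \<Longrightarrow> norm (a k j) \<le> inverse (real (Suc k))"
      "\<And>k. monic_interp_pair n (K k) (a k) (p k) (q k)"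
      "\<And>k. \<not> norm (coeff (q k) i - coeff Q0 i) < \<epsilon>"
    by metis
  have deg: "degree (p k) \<le> n" "degree (q k) = n" and monic: "coeff (q k) n = 1"
    and interp: "hermite_interp exp (K k) (a k) (p k) (q k)" for k
    using H(4)[of k] by (auto simp: monic_interp_pair_def)
  have nz: "p k \<noteq> 0 \<or> q k \<noteq> 0" for k
    using monic[of k] by auto
  have vanish: "coeff (p k) i = 0" "coeff (q k) i = 0" if "Suc n \<le> i" for k i
    using deg[of k] that by (auto intro!: coeff_eq_0)
  have "\<exists>r c P Q. strict_mono (r :: nat \<Rightarrow> nat) \<and>
    (\<forall>i. (\<lambda>k. c k * coeff (p (r k)) i) \<longlonglongrightarrow> coeff P i) \<and>
    (\<forall>i. (\<lambda>k. c k * coeff (q (r k)) i) \<longlonglongrightarrow> coeff Q i) \<and>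
    (P \<noteq> 0 \<or> Q \<noteq> 0) \<and> (\<forall>i\<ge>Suc n. coeff P i = 0) \<and> (\<forall>i\<ge>Suc n. coeff Q i = 0) \<and>
    hermite_interp exp {..<2 * n + 1} (\<lambda>_. 0) P Q"
  proof (rule small_nodes_limit[where K = K and d = "\<lambda>k. inverse (real (Suc k))"])
    show "0 \<le> inverse (real (Suc k))" for k
      by simp
  qed (fact H nz vanish interp LIMSEQ_inverse_real_of_nat)+
  then obtain r c P Q where lim: "\<And>i. (\<lambda>k. c k * coeff (q (r k)) i) \<longlonglongrightarrow> coeff Q i"
    and PQ: "P \<noteq> 0 \<or> Q \<noteq> 0" "\<forall>i\<ge>Suc n. coeff P i = 0" "\<forall>i\<ge>Suc n. coeff Q i = 0"
    and interp0: "hermite_interp exp {..<2 * n + 1} (\<lambda>_. 0) P Q"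
    by blast
  have degPQ: "degree P \<le> n" "degree Q \<le> n"
    using PQ(2,3) by (auto intro!: degree_le)
  have Q0: "degree P0 \<le> n" "degree Q0 = n" "coeff Q0 n = 1" "coprime P0 Q0"
    and interp00: "hermite_interp exp {..<2 * n + 1} (\<lambda>_. 0) P0 Q0"
    using pade by (auto simp: monic_interp_pair_def)
  have "P * Q0 = P0 * Q"
    by (rule hermite_interp_cross_mult[OF interp0 interp00]) (use degPQ Q0 in auto)
  \<comment> \<open>As \<open>Q0\<close> already has the maximal degree, \<open>Q\<close> is a constant multiple of it.\<close>
  then have "Q0 dvd P0 * Q"
    by (metis dvd_triv_right)
  then have "Q0 dvd Q"
    using Q0(4) coprime_commute coprime_dvd_mult_right_iff by blast
  then obtain t where t: "Q = Q0 * t"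
    by blast
  have "Q \<noteq> 0"
    by (rule hermite_interp_denominator_nonzero[OF interp0 PQ(1)]) (use degPQ in auto)
  then have "degree Q = n + degree t"
    using t Q0 by (auto simp: degree_mult_eq)
  then obtain b where b: "t = [:b:]"
    using degPQ by (metis add_le_same_cancel1 degree_eq_zeroE le_zero_eq)
  have "b \<noteq> 0" and Q: "coeff Q i = b * coeff Q0 i" for i
    using \<open>Q \<noteq> 0\<close> t b by auto
  have c_lim: "c \<longlonglongrightarrow> b"
    using lim[of n] by (simp add: monic Q Q0)
  have "(\<lambda>k. c k * coeff (q (r k)) i / c k) \<longlonglongrightarrow> coeff Q i / b"
    by (intro tendsto_divide lim c_lim \<open>b \<noteq> 0\<close>)
  moreover have "\<forall>\<^sub>F k in sequentially. c k * coeff (q (r k)) i / c k = coeff (q (r k)) i"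
    using tendsto_imp_eventually_ne[OF c_lim \<open>b \<noteq> 0\<close>] by eventually_elim simp
  ultimately have "(\<lambda>k. coeff (q (r k)) i) \<longlonglongrightarrow> coeff Q i / b"
    by (rule Lim_transform_eventually)
  then have "(\<lambda>k. coeff (q (r k)) i) \<longlonglongrightarrow> coeff Q0 i"
    using Q \<open>b \<noteq> 0\<close> by simp
  then have "\<forall>\<^sub>F k in sequentially. norm (coeff (q (r k)) i - coeff Q0 i) < \<epsilon>"
    using \<open>\<epsilon> > 0\<close> tendstoD by (fastforce simp: dist_norm)
  then show False
    using H(5) by (simp add: eventually_sequentially)
qed

section \<open>The rational functions as fractions\<close>

lemma rat_poles_Fract:
  assumes "coprime p q" "q \<noteq> 0"
  shows "rat_poles (Fract p q) = proots q"
proof -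
  have "quot_of_fract (Fract p q) = normalize_quot (p, q)"
    using quot_of_fract_quot_to_fract[of "(p, q)"] assms(2) by (simp add: quot_to_fract_def)
  moreover obtain d where d: "q = snd (normalize_quot (p, q)) * d" "d dvd p" "d dvd q" "d \<noteq> 0"
    using normalize_quotE[OF assms(2), of p] by metis
  moreover have "is_unit d"
    using assms(1) d coprime_common_divisor by blast
  then obtain c where "d = [:c:]" "c \<noteq> 0"
    using d(4) by (metis degree_eq_zeroE is_unit_iff_degree pCons_0_0)
  ultimately show ?thesis
    unfolding rat_poles_def using proots_smult[of c "snd (normalize_quot (p, q))"] by simp
qed

text \<open>
  Every solution of the linearized problem represents the same element of the fraction field, so
  the definite description in the definition is met by any of them.
\<close>
lemma rat_interpolant_eq:
  assumes "solves_linearized n \<omega> x p q"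
  shows "rat_interpolant n \<omega> x = Fract p q"
proof -
  have interp: "hermite_interp (\<lambda>z. exp (complex_of_real \<omega> * z)) {1..2*n+1} (\<lambda>j. \<i> * complex_of_real (x j)) p q \<and>
      degree p \<le> n \<and> degree q \<le> n \<and> q \<noteq> 0" if "solves_linearized n \<omega> x p q" for p q
  proof -
    have *: "hermite_interp (\<lambda>z. exp (complex_of_real \<omega> * z)) {1..2*n+1} (\<lambda>j. \<i> * complex_of_real (x j)) p q"
      and deg: "degree p \<le> n" "degree q \<le> n" "p \<noteq> 0 \<or> q \<noteq> 0"
      using that unfolding solves_linearized_def hermite_interp_def by auto
    moreover have "q \<noteq> 0"
      by (rule hermite_interp_denominator_nonzero[OF * deg(3)]) (use deg in auto)
    ultimately show ?thesis
      by blast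
  qed
  show ?thesis
    unfolding rat_interpolant_def
  proof (rule the_equality)
    show "\<exists>p' q'. solves_linearized n \<omega> x p' q' \<and> Fract p q = Fract p' q'"
      using assms by blast
    fix r assume "\<exists>p q. solves_linearized n \<omega> x p q \<and> r = Fract p q"
    then obtain p' q' where pq': "solves_linearized n \<omega> x p' q'" "r = Fract p' q'"
      by blast
    have "p' * q = p * q'"
      by (rule hermite_interp_cross_mult[of _ "{1..2*n+1}"])
        (use interp[OF assms] interp[OF pq'(1)] in auto)
    then show "r = Fract p q"
      using pq'(2) interp[OF assms] interp[OF pq'(1)] by (simp add: eq_fract)
  qed
qed

text \<open>
  Near 0 the denominators are bounded and bounded away from 0, so the asymptotic condition on
  \<open>p/q - exp\<close> is the same as a zero of order \<open>2n+1\<close> of \<open>p - q exp\<close>.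
\<close>
lemma pade_exp_eq:
  assumes "hermite_interp exp {..<2 * n + 1} (\<lambda>_. 0) P Q" "degree P \<le> n" "degree Q \<le> n" "poly Q 0 \<noteq> 0"
  shows "pade_exp n = Fract P Q"
  unfolding pade_exp_def
proof (rule the_equality)
  obtain v where v: "v holomorphic_on UNIV" "\<And>z. poly P z - poly Q z * exp z = z ^ (2 * n + 1) * v z"
    using assms(1) by (rule hermite_interpE) (use that in simp)
  define c where "c = inverse (poly Q 0)"
  have c: "c \<noteq> 0" "c * poly Q 0 = 1"
    using assms(4) by (auto simp: c_def)
  have tendsto0: "f \<midarrow>0\<rightarrow> f 0" if "f holomorphic_on UNIV" for f :: "complex \<Rightarrow> complex"
    using holomorphic_on_imp_continuous_on[OF that] by (simp add: continuous_on_eq_continuous_within continuous_within)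
  have "((\<lambda>z. norm (v z / poly Q z)) \<longlongrightarrow> norm (v 0 / poly Q 0)) (at 0)"
    using assms(4) by (intro tendsto_intros tendsto0 v) (auto intro!: holomorphic_intros)
  then have "\<forall>\<^sub>F z in at 0. norm (v z / poly Q z) < norm (v 0 / poly Q 0) + 1"
    by (rule order_tendstoD) simp
  moreover have "\<forall>\<^sub>F z in at 0. poly Q z \<noteq> 0"
    using assms(4) poly_isCont[where p = Q and x = 0] unfolding isCont_def by (intro tendsto_imp_eventually_ne)
  ultimately have "\<forall>\<^sub>F z in at 0. norm (poly (smult c P) z / poly (smult c Q) z - exp z) \<le>
      (norm (v 0 / poly Q 0) + 1) * norm (complex_of_real (norm z ^ (2 * n + 1)))"
  proof eventually_elim
    case (elim z)
    have "poly (smult c P) z / poly (smult c Q) z - exp z = z ^ (2 * n + 1) * (v z / poly Q z)"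
      using elim(2) c v(2)[of z] by (simp add: field_simps)
    then have "norm (poly (smult c P) z / poly (smult c Q) z - exp z) =
        norm (v z / poly Q z) * norm z ^ (2 * n + 1)"
      by (simp only: norm_mult norm_power mult.commute)
    also have "\<dots> \<le> (norm (v 0 / poly Q 0) + 1) * norm z ^ (2 * n + 1)"
      using elim(1) by (intro mult_right_mono) auto
    also have "norm z ^ (2 * n + 1) = norm (complex_of_real (norm z ^ (2 * n + 1)))"
      by (simp only: norm_of_real) simp
    finally show ?case .
  qed
  then have "(\<lambda>z. poly (smult c P) z / poly (smult c Q) z - exp z) \<in> O[at 0](\<lambda>z. complex_of_real (norm z ^ (2 * n + 1)))"
    by (rule bigoI)
  moreover have "Fract P Q = Fract (smult c P) (smult c Q)"
    using c assms(4) by (subst eq_fract) auto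
  ultimately show "\<exists>p q. degree p \<le> n \<and> degree q \<le> n \<and> poly q 0 = 1 \<and> Fract P Q = Fract p q \<and>
      (\<lambda>z. poly p z / poly q z - exp z) \<in> O[at 0](\<lambda>z. complex_of_real (norm z ^ (2*n+1)))"
    using assms(2,3) c by (intro exI[of _ "smult c P"] exI[of _ "smult c Q"]) simp
next
  fix r
  assume "\<exists>p q. degree p \<le> n \<and> degree q \<le> n \<and> poly q 0 = 1 \<and> r = Fract p q \<and>
      (\<lambda>z. poly p z / poly q z - exp z) \<in> O[at 0](\<lambda>z. complex_of_real (norm z ^ (2*n+1)))"
  then obtain p q where pq: "degree p \<le> n" "degree q \<le> n" "poly q 0 = 1" "r = Fract p q"
    and O: "(\<lambda>z. poly p z / poly q z - exp z) \<in> O[at 0](\<lambda>z. complex_of_real (norm z ^ (2*n+1)))"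
    by blast
  obtain C where C: "C > 0" "\<forall>\<^sub>F z in at 0. norm (poly p z / poly q z - exp z) \<le>
      C * norm (complex_of_real (norm z ^ (2*n+1)))"
    using O by (rule landau_o.bigE)
  have q_lim: "((\<lambda>z. poly q z) \<longlongrightarrow> 1) (at 0)"
    using pq(3) by (metis isCont_def poly_isCont)
  have "\<forall>\<^sub>F z in at 0. norm (poly q z) < 2"
    using order_tendstoD(2)[OF tendsto_norm[OF q_lim], of 2] by simp
  moreover have "\<forall>\<^sub>F z in at 0. poly q z \<noteq> 0"
    using tendsto_imp_eventually_ne[OF q_lim] by simp
  ultimately have "\<forall>\<^sub>F z in at 0. norm (poly p z - poly q z * exp z) \<le> (2 * C) * norm z ^ (2 * n + 1)"
    using C(2)
  proof eventually_elim
    case (elim z)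
    have "poly p z - poly q z * exp z = poly q z * (poly p z / poly q z - exp z)"
      using elim(2) by (simp add: field_simps)
    then have "norm (poly p z - poly q z * exp z) = norm (poly q z) * norm (poly p z / poly q z - exp z)"
      by (simp add: norm_mult)
    also have "\<dots> \<le> 2 * (C * norm (complex_of_real (norm z ^ (2*n+1))))"
      using elim C(1) by (intro mult_mono) auto
    also have "norm (complex_of_real (norm z ^ (2 * n + 1))) = norm z ^ (2 * n + 1)"
      by (simp only: norm_of_real) simp
    finally show ?case
      by simp
  qed
  then obtain v where "v holomorphic_on UNIV" "\<And>z. poly p z - poly q z * exp z = z ^ (2 * n + 1) * v z"
    by (rule entire_divide_power[rotated]) (auto intro!: holomorphic_intros)
  then have "hermite_interp exp {..<2 * n + 1} (\<lambda>_. 0) p q"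
    by (intro hermite_interpI[of v]) auto
  then have "p * Q = P * q"
    by (rule hermite_interp_cross_mult[OF _ assms(1)]) (use pq assms in auto)
  moreover have "q \<noteq> 0" "Q \<noteq> 0"
    using pq(3) assms(4) by auto
  ultimately show "r = Fract P Q"
    using pq(4) by (simp add: eq_fract)
qed

section \<open>Continuity of polynomial roots\<close>

text \<open>
  By Horner's scheme the coefficients of the quotient are computed from the top downwards, which
  gives an induction on the distance from the degree.
\<close>
lemma coeff_synthetic_div_tendsto:
  fixes q :: "'a \<Rightarrow> complex poly"
  assumes "\<And>t. degree (q t) \<le> n" "degree q0 \<le> n"
    and q: "\<And>i. ((\<lambda>t. coeff (q t) i) \<longlongrightarrow> coeff q0 i) F" and s: "(s \<longlongrightarrow> s0) F"
  shows "((\<lambda>t. coeff (synthetic_div (q t) (s t)) i) \<longlongrightarrow> coeff (synthetic_div q0 s0) i) F"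
proof (induction "n - i" arbitrary: i)
  case 0
  then have "coeff (synthetic_div p c) i = 0" if "degree p \<le> n" for p and c :: complex
  proof (cases "degree p = 0")
    case True
    then have "synthetic_div p c = 0"
      by (simp add: synthetic_div_eq_0_iff)
    then show ?thesis
      by simp
  next
    case False
    then show ?thesis
      using 0 that by (intro coeff_eq_0) (simp add: degree_synthetic_div)
  qed
  then show ?case
    using assms(1,2) by simp
next
  case (Suc k)
  have rec: "coeff (synthetic_div p c) i = coeff p (Suc i) + c * coeff (synthetic_div p c) (Suc i)"
    for p and c :: complex
    using arg_cong[OF synthetic_div_correct[of p c], of "\<lambda>f. coeff f (Suc i)"] by simp
  have "((\<lambda>t. coeff (synthetic_div (q t) (s t)) (Suc i)) \<longlongrightarrow> coeff (synthetic_div q0 s0) (Suc i)) F"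
    using Suc by (intro Suc.hyps(1)) linarith
  then show ?case
    unfolding rec[of _ _] by (intro tendsto_intros q s)
qed

text \<open>
  The modulus of a monic polynomial at \<open>z\<close> is the product of the distances from \<open>z\<close> to the
  roots, and the root closest to \<open>z\<close> contributes the smallest factor.
\<close>
lemma exists_root_near:
  fixes p :: "complex poly"
  assumes "lead_coeff p = 1" "degree p = n" "n > 0"
  shows "\<exists>w. poly p w = 0 \<and> norm (z - w) ^ n \<le> norm (poly p z)"
proof -
  have "p \<noteq> 0" and sz: "size (proots p) = n"
    using assms size_proots_complex by auto
  define R where "R = (\<lambda>w. norm (z - w)) ` set_mset (proots p)"
  have "finite R" "R \<noteq> {}"
    using sz assms(3) by (auto simp: R_def simp del: set_count_proots)
  then obtain w where w: "w \<in># proots p" "norm (z - w) = Min R"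
    using Min_in unfolding R_def by (metis (no_types, lifting) imageE)
  have near: "norm (z - w) \<le> norm (z - x)" if "x \<in># proots p" for x
    unfolding w(2) using that \<open>finite R\<close> by (intro Min_le) (auto simp: R_def simp del: set_count_proots)
  have "norm (z - w) ^ size A \<le> norm (poly (\<Prod>x\<in>#A. [:-x, 1:]) z)"
    if "\<And>x. x \<in># A \<Longrightarrow> norm (z - w) \<le> norm (z - x)" for A
    using that
  proof (induction A)
    case (add x A)
    then have "norm (z - w) * norm (z - w) ^ size A \<le>
        norm (z - x) * norm (poly (\<Prod>x\<in>#A. [:-x, 1:]) z)"
      by (intro mult_mono) auto
    also have "\<dots> = norm (poly (\<Prod>x\<in>#add_mset x A. [:-x, 1:]) z)"
      by (simp only: image_mset_add_mset prod_mset.add_mset poly_mult norm_mult) simp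
    finally show ?case
      by simp
  qed simp
  from this[of "proots p", OF near] have "norm (z - w) ^ n \<le> norm (poly (\<Prod>x\<in>#proots p. [:-x, 1:]) z)"
    using sz by simp
  also have "(\<Prod>x\<in>#proots p. [:-x, 1:]) = p"
    using complex_poly_decompose_multiset[of p] assms(1) by simp
  finally show ?thesis
    using w(1) \<open>p \<noteq> 0\<close> by auto
qed

text \<open>
  The roots depend continuously on the coefficients, along an arbitrary filter. At a root \<open>z\<close> of
  the limit the values tend to 0, so the roots closest to \<open>z\<close> tend to \<open>z\<close>. Dividing
  out these roots leaves polynomials whose coefficients still converge.
\<close>
lemma roots_tendsto:
  fixes q :: "'a \<Rightarrow> complex poly" and s0 :: "nat \<Rightarrow> complex"
  assumes "\<And>t. lead_coeff (q t) = 1" "\<And>t. degree (q t) = n" "lead_coeff q0 = 1" "degree q0 = n"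
    and "\<And>i. ((\<lambda>t. coeff (q t) i) \<longlongrightarrow> coeff q0 i) F"
    and "proots q0 = image_mset s0 (mset_set {1..n})"
  shows "\<exists>s. (\<forall>t. proots (q t) = image_mset (\<lambda>l. s l t) (mset_set {1..n})) \<and>
    (\<forall>l\<in>{1..n}. (s l \<longlongrightarrow> s0 l) F)"
  using assms
proof (induction n arbitrary: q q0)
  case 0
  have "proots p = {#}" if "degree p = 0" for p :: "complex poly"
    using that size_proots_complex[of p] by simp
  then show ?case
    using 0(2) by simp
next
  case (Suc n)
  define z where "z = s0 (Suc n)"
  have ins: "mset_set {1..Suc n} = add_mset (Suc n) (mset_set {1..n})"
    by (simp add: atLeastAtMostSuc_conv)
  have nz: "q0 \<noteq> 0" "q t \<noteq> 0" for t
    using Suc.prems(1)[of t] Suc.prems(3) by auto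
  have root: "poly q0 z = 0"
  proof -
    have "z \<in># proots q0"
      unfolding Suc.prems(6) ins by (simp add: z_def)
    then show ?thesis
      using nz(1) by simp
  qed
  have "\<forall>t. \<exists>w. poly (q t) w = 0 \<and> norm (z - w) ^ Suc n \<le> norm (poly (q t) z)"
    using exists_root_near[OF Suc.prems(1,2)] by simp
  then obtain w where w: "\<And>t. poly (q t) (w t) = 0" "\<And>t. norm (z - w t) ^ Suc n \<le> norm (poly (q t) z)"
    by metis
  have poly_sum: "poly p z = (\<Sum>i\<le>Suc n. coeff p i * z ^ i)" if "degree p = Suc n" for p
    using that by (simp add: poly_altdef)
  have "((\<lambda>t. poly (q t) z) \<longlongrightarrow> poly q0 z) F"
    unfolding poly_sum[OF Suc.prems(2)] poly_sum[OF Suc.prems(4)] by (intro tendsto_intros Suc.prems(5))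
  then have lim0: "((\<lambda>t. norm (poly (q t) z)) \<longlongrightarrow> 0) F"
    using root tendsto_norm_zero by simp
  have root_lim: "((\<lambda>t. root (Suc n) (norm (poly (q t) z))) \<longlongrightarrow> 0) F"
    using tendsto_real_root[OF lim0, of "Suc n"] by simp
  have dist_le: "norm (z - w t) \<le> root (Suc n) (norm (poly (q t) z))" for t
  proof -
    have "norm (z - w t) = root (Suc n) (norm (z - w t) ^ Suc n)"
      by (rule real_root_power_cancel[symmetric]) auto
    also have "\<dots> \<le> root (Suc n) (norm (poly (q t) z))"
      by (rule real_root_le_mono[OF _ w(2)]) simp
    finally show ?thesis .
  qed
  have "((\<lambda>t. z - w t) \<longlongrightarrow> 0) F"
    by (rule Lim_null_comparison[OF _ root_lim]) (rule always_eventually, rule allI, rule dist_le)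
  from tendsto_diff[OF tendsto_const[of z] this] have w_lim: "(w \<longlongrightarrow> z) F"
    by simp
  have split: "p = [:-c, 1:] * synthetic_div p c" if "poly p c = 0" for p and c :: complex
    using synthetic_div_correct'[of c p] that by simp
  have monic: "lead_coeff (synthetic_div p c) = 1" "degree (synthetic_div p c) = n"
    "proots p = add_mset c (proots (synthetic_div p c))"
    if "poly p c = 0" "lead_coeff p = 1" "degree p = Suc n" for p and c :: complex
  proof -
    show "degree (synthetic_div p c) = n"
      using that by (simp add: degree_synthetic_div)
    have "lead_coeff p = lead_coeff [:-c, 1:] * lead_coeff (synthetic_div p c)"
      using arg_cong[OF split[OF that(1)], of lead_coeff] by (simp only: lead_coeff_mult)
    then show "lead_coeff (synthetic_div p c) = 1"
      using that by simp
    then have "synthetic_div p c \<noteq> 0"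
      by auto
    have "proots p = proots ([:-c, 1:] * synthetic_div p c)"
      using split[OF that(1)] by simp
    also have "\<dots> = add_mset c (proots (synthetic_div p c))"
      by (subst proots_mult) (use \<open>synthetic_div p c \<noteq> 0\<close> in auto)
    finally show "proots p = add_mset c (proots (synthetic_div p c))" .
  qed
  note m = monic[OF w(1) Suc.prems(1,2)] and m0 = monic[OF root Suc.prems(3,4)]
  have "\<exists>s. (\<forall>t. proots (synthetic_div (q t) (w t)) = image_mset (\<lambda>l. s l t) (mset_set {1..n})) \<and>
      (\<forall>l\<in>{1..n}. (s l \<longlongrightarrow> s0 l) F)"
  proof (rule Suc.IH[OF m(1,2) m0(1,2)])
    show "((\<lambda>t. coeff (synthetic_div (q t) (w t)) i) \<longlongrightarrow> coeff (synthetic_div q0 z) i) F" for i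
      by (rule coeff_synthetic_div_tendsto[of _ "Suc n"]) (use Suc.prems w_lim in auto)
    show "proots (synthetic_div q0 z) = image_mset s0 (mset_set {1..n})"
    proof -
      have "add_mset z (proots (synthetic_div q0 z)) = add_mset z (image_mset s0 (mset_set {1..n}))"
        unfolding m0(3)[symmetric] Suc.prems(6) ins by (simp add: z_def)
      then show ?thesis
        by simp
    qed
  qed
  then obtain s where s: "\<And>t. proots (synthetic_div (q t) (w t)) = image_mset (\<lambda>l. s l t) (mset_set {1..n})"
    "\<And>l. l \<in> {1..n} \<Longrightarrow> (s l \<longlongrightarrow> s0 l) F"
    by blast
  define s' where "s' = s(Suc n := w)"
  have "proots (q t) = image_mset (\<lambda>l. s' l t) (mset_set {1..Suc n})" for t
  proof -
    have "image_mset (\<lambda>l. s' l t) (mset_set {1..n}) = image_mset (\<lambda>l. s l t) (mset_set {1..n})"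
      by (intro image_mset_cong) (auto simp: s'_def)
    then show ?thesis
      unfolding ins by (simp add: m(3) s(1) s'_def)
  qed
  moreover have "(s' l \<longlongrightarrow> s0 l) F" if "l \<in> {1..Suc n}" for l
    using that s(2) w_lim by (cases "l = Suc n") (auto simp: s'_def z_def)
  ultimately show ?case
    by blast
qed

section \<open>Rescaling and convergence of the poles\<close>

lemma proots_rescale:
  fixes p :: "complex poly"
  assumes "c \<noteq> 0"
  shows "proots (pcompose p [:0, c:]) = image_mset (\<lambda>z. z / c) (proots p)"
proof (cases "p = 0")
  case False
  have prod: "proots (pcompose (\<Prod>x\<in>#A. [:-x, 1:]) [:0, c:]) = image_mset (\<lambda>z. z / c) A" for A
  proof (induction A)
    case (add x A)
    have "pcompose [:-x, 1:] [:0, c:] = smult c [:-(x / c), 1:]"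
      using assms by (simp add: pcompose_pCons)
    then have "pcompose (\<Prod>x\<in>#add_mset x A. [:-x, 1:]) [:0, c:] =
        smult c [:-(x / c), 1:] * pcompose (\<Prod>x\<in>#A. [:-x, 1:]) [:0, c:]"
      by (simp only: image_mset_add_mset prod_mset.add_mset pcompose_mult)
    moreover have "pcompose (\<Prod>x\<in>#A. [:-x, 1:]) [:0, c:] \<noteq> 0"
      using assms by (subst pcompose_eq_0_iff) (auto simp: prod_mset_zero_iff)
    then have "proots (smult c [:-(x / c), 1:] * pcompose (\<Prod>x\<in>#A. [:-x, 1:]) [:0, c:]) =
        proots (smult c [:-(x / c), 1:]) + proots (pcompose (\<Prod>x\<in>#A. [:-x, 1:]) [:0, c:])"
      using assms by (intro proots_mult) auto
    ultimately have "proots (pcompose (\<Prod>x\<in>#add_mset x A. [:-x, 1:]) [:0, c:]) =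
        proots (smult c [:-(x / c), 1:]) + image_mset (\<lambda>z. z / c) A"
      by (simp only: add.IH)
    then show ?case
      by (simp only: proots_smult[OF assms] proots_linear_factor) simp
  qed (simp add: pcompose_1)
  have "pcompose p [:0, c:] = smult (lead_coeff p) (pcompose (\<Prod>x\<in>#proots p. [:-x, 1:]) [:0, c:])"
    by (subst complex_poly_decompose_multiset[of p, symmetric]) (rule pcompose_smult)
  then show ?thesis
    using prod False by simp
qed simp

text \<open>
  The substitution \<open>z \<mapsto> \<omega> z\<close> turns nodes \<open>\<i> \<omega> x\<^sub>j\<close> for \<open>exp z\<close> into nodes \<open>\<i> x\<^sub>j\<close>
  for \<open>exp (\<omega> z)\<close>; this is where the factor \<open>\<omega>\<close> in front of the poles comes from.
\<close>
lemma solves_linearized_rescale: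
  assumes "\<omega> > 0" and deg: "degree P \<le> n" "degree Q \<le> n" and "Q \<noteq> 0"
    and interp: "hermite_interp exp {1..2*n+1} (\<lambda>j. \<i> * complex_of_real (\<omega> * x j)) P Q"
  shows "solves_linearized n \<omega> x (pcompose P [:0, complex_of_real \<omega>:]) (pcompose Q [:0, complex_of_real \<omega>:])"
proof -
  obtain v where v: "v holomorphic_on UNIV"
      "\<And>z. poly P z - poly Q z * exp z = (\<Prod>j\<in>{1..2*n+1}. z - \<i> * complex_of_real (\<omega> * x j)) * v z"
    using interp by (rule hermite_interpE) (rule that)
  have "(\<Prod>j\<in>{1..2*n+1}. complex_of_real \<omega> * z - \<i> * complex_of_real (\<omega> * x j)) =
      complex_of_real \<omega> ^ (2 * n + 1) * (\<Prod>j = 1..2*n+1. z - \<i> * complex_of_real (x j))" for z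
  proof -
    have "(\<Prod>j\<in>{1..2*n+1}. complex_of_real \<omega> * z - \<i> * complex_of_real (\<omega> * x j)) =
        (\<Prod>j\<in>{1..2*n+1}. complex_of_real \<omega> * (z - \<i> * complex_of_real (x j)))"
      by (intro prod.cong) (auto simp: algebra_simps)
    then show ?thesis
      by (simp only: prod.distrib prod_constant card_atLeastAtMost) simp
  qed
  then have "poly (pcompose P [:0, complex_of_real \<omega>:]) z -
      poly (pcompose Q [:0, complex_of_real \<omega>:]) z * exp (complex_of_real \<omega> * z) =
      (\<Prod>j = 1..2*n+1. z - \<i> * complex_of_real (x j)) *
        (complex_of_real \<omega> ^ (2 * n + 1) * v (complex_of_real \<omega> * z))" for z
    using v(2)[of "complex_of_real \<omega> * z"] by (simp add: poly_pcompose mult_ac)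
  moreover have "(\<lambda>z. complex_of_real \<omega> ^ (2 * n + 1) * v (complex_of_real \<omega> * z)) holomorphic_on UNIV"
    using holomorphic_on_compose_gen[of "\<lambda>z. complex_of_real \<omega> * z" UNIV v UNIV] v(1)
    by (intro holomorphic_intros) (auto simp: o_def intro!: holomorphic_intros)
  moreover have "pcompose Q [:0, complex_of_real \<omega>:] \<noteq> 0"
    using \<open>Q \<noteq> 0\<close> \<open>\<omega> > 0\<close> by (subst pcompose_eq_0_iff) auto
  ultimately show ?thesis
    unfolding solves_linearized_def using deg \<open>\<omega> > 0\<close> by (auto simp: degree_pcompose)
qed

lemma rat_poles_interpolant:
  assumes "\<omega> > 0"
    and pair: "monic_interp_pair n {1..2*n+1} (\<lambda>j. \<i> * complex_of_real (\<omega> * x j)) P Q"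
  shows "rat_poles (rat_interpolant n \<omega> x) = image_mset (\<lambda>z. z / complex_of_real \<omega>) (proots Q)"
proof -
  have PQ: "degree P \<le> n" "degree Q = n" "lead_coeff Q = 1" "coprime P Q"
      "hermite_interp exp {1..2*n+1} (\<lambda>j. \<i> * complex_of_real (\<omega> * x j)) P Q"
    using pair by (auto simp: monic_interp_pair_def)
  then have "Q \<noteq> 0"
    by auto
  let ?s = "\<lambda>p. pcompose p [:0, complex_of_real \<omega>:]"
  have "?s Q \<noteq> 0"
    using \<open>Q \<noteq> 0\<close> \<open>\<omega> > 0\<close> by (subst pcompose_eq_0_iff) auto
  moreover have "coprime (?s P) (?s Q)"
    unfolding coprime_iff_no_common_root[OF \<open>?s Q \<noteq> 0\<close>] poly_pcompose
    using coprime_poly_0[OF PQ(4)] by blast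
  moreover have "solves_linearized n \<omega> x (?s P) (?s Q)"
    by (rule solves_linearized_rescale) (use assms PQ \<open>Q \<noteq> 0\<close> in auto)
  ultimately show ?thesis
    using rat_interpolant_eq rat_poles_Fract proots_rescale[of "complex_of_real \<omega>" Q] \<open>\<omega> > 0\<close> by simp
qed

lemma poles_converge:
  fixes x :: "real \<Rightarrow> nat \<Rightarrow> real"
  assumes pade: "monic_interp_pair n {..<2 * n + 1} (\<lambda>_. 0) P0 Q0"
    and s_hat: "proots Q0 = image_mset s_hat (mset_set {1..n})"
    and x: "\<forall>\<omega>>0. \<forall>j\<in>{1..2*n+1}. x \<omega> j \<in> {-1..1}"
  shows "\<exists>s :: nat \<Rightarrow> real \<Rightarrow> complex.
        (\<forall>\<^sub>F \<omega> in at_right 0.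
           rat_poles (rat_interpolant n \<omega> (x \<omega>)) = image_mset (\<lambda>l. s l \<omega>) (mset_set {1..n})) \<and>
        (\<forall>l\<in>{1..n}. ((\<lambda>\<omega>. complex_of_real \<omega> * s l \<omega>) \<longlongrightarrow> s_hat l) (at_right 0))"
proof -
  define a where "a \<omega> j = \<i> * complex_of_real (\<omega> * x \<omega> j)" for \<omega> j
  have a_le: "\<forall>j\<in>{1..2*n+1}. norm (a \<omega> j) \<le> \<delta>" if "0 < \<omega>" "\<omega> \<le> \<delta>" for \<omega> \<delta>
  proof
    fix j assume "j \<in> {1..2*n+1}"
    then have "\<bar>x \<omega> j\<bar> \<le> 1"
      using x that by force
    then have "\<omega> * \<bar>x \<omega> j\<bar> \<le> \<omega>"
      using that by (simp add: mult_left_le)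
    also have "\<omega> * \<bar>x \<omega> j\<bar> = norm (a \<omega> j)"
      using that by (simp add: a_def norm_mult)
    finally show "norm (a \<omega> j) \<le> \<delta>"
      using that by linarith
  qed
  have small: "\<forall>\<^sub>F \<omega> in at_right 0. 0 < \<omega> \<and> \<omega> \<le> \<delta>" if "\<delta> > 0" for \<delta> :: real
    using that unfolding eventually_at_right_field by (intro exI[of _ \<delta>]) auto
  obtain \<delta> where \<delta>: "\<delta> > 0" "\<And>(K :: nat set) a. \<lbrakk>finite K; card K = 2 * n + 1; \<forall>j\<in>K. norm (a j) \<le> \<delta>\<rbrakk> \<Longrightarrow>
      \<exists>p q. monic_interp_pair n K a p q"
    using monic_interp_pair_exists[of n] by metis
  \<comment> \<open>Where no interpolation pair is available, \<open>Q0\<close> is a harmless default value that keeps the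
    family monic of degree \<open>n\<close> for all parameters.\<close>
  have "\<forall>\<omega>. \<exists>q. lead_coeff q = 1 \<and> degree q = n \<and>
      (0 < \<omega> \<and> \<omega> \<le> \<delta> \<longrightarrow> (\<exists>p. monic_interp_pair n {1..2*n+1} (a \<omega>) p q))"
  proof
    fix \<omega>
    show "\<exists>q. lead_coeff q = 1 \<and> degree q = n \<and>
      (0 < \<omega> \<and> \<omega> \<le> \<delta> \<longrightarrow> (\<exists>p. monic_interp_pair n {1..2*n+1} (a \<omega>) p q))"
    proof (cases "0 < \<omega> \<and> \<omega> \<le> \<delta>")
      case True
      then obtain p q where "monic_interp_pair n {1..2*n+1} (a \<omega>) p q"
        using \<delta>(2)[of "{1..2*n+1}" "a \<omega>"] a_le[of \<omega> \<delta>] by auto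
      then show ?thesis
        by (intro exI[of _ q]) (auto simp: monic_interp_pair_def)
    next
      case False
      then show ?thesis
        using pade by (intro exI[of _ Q0]) (auto simp: monic_interp_pair_def)
    qed
  qed
  then obtain q where q: "\<And>\<omega>. lead_coeff (q \<omega>) = 1" "\<And>\<omega>. degree (q \<omega>) = n"
      "\<And>\<omega>. \<lbrakk>0 < \<omega>; \<omega> \<le> \<delta>\<rbrakk> \<Longrightarrow> \<exists>p. monic_interp_pair n {1..2*n+1} (a \<omega>) p (q \<omega>)"
    by metis
  have "((\<lambda>\<omega>. coeff (q \<omega>) i) \<longlongrightarrow> coeff Q0 i) (at_right 0)" for i
  proof (rule tendstoI)
    fix \<epsilon> :: real assume "\<epsilon> > 0"
    then obtain \<delta>' where \<delta>': "\<delta>' > 0" "\<And>(K :: nat set) a p q. \<lbrakk>finite K; card K = 2 * n + 1;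
        \<forall>j\<in>K. norm (a j) \<le> \<delta>'; monic_interp_pair n K a p q\<rbrakk> \<Longrightarrow> norm (coeff q i - coeff Q0 i) < \<epsilon>"
      using denominator_converges[OF pade, of \<epsilon> i] by metis
    show "\<forall>\<^sub>F \<omega> in at_right 0. dist (coeff (q \<omega>) i) (coeff Q0 i) < \<epsilon>"
      using small[OF \<delta>(1)] small[OF \<delta>'(1)]
    proof eventually_elim
      case (elim \<omega>)
      then obtain p where "monic_interp_pair n {1..2*n+1} (a \<omega>) p (q \<omega>)"
        using q(3) by blast
      then show ?case
        unfolding dist_norm using elim a_le by (intro \<delta>'(2)[of "{1..2*n+1}" "a \<omega>" p]) auto
    qed
  qed
  moreover have "lead_coeff Q0 = 1" "degree Q0 = n"
    using pade by (auto simp: monic_interp_pair_def)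
  ultimately have "\<exists>s. (\<forall>\<omega>. proots (q \<omega>) = image_mset (\<lambda>l. s l \<omega>) (mset_set {1..n})) \<and>
      (\<forall>l\<in>{1..n}. (s l \<longlongrightarrow> s_hat l) (at_right 0))"
    by (intro roots_tendsto[OF q(1,2) _ _ _ s_hat])
  then obtain s where s: "\<And>\<omega>. proots (q \<omega>) = image_mset (\<lambda>l. s l \<omega>) (mset_set {1..n})"
      "\<And>l. l \<in> {1..n} \<Longrightarrow> (s l \<longlongrightarrow> s_hat l) (at_right 0)"
    by blast
  define s' where "s' l \<omega> = s l \<omega> / complex_of_real \<omega>" for l \<omega>
  have "\<forall>\<^sub>F \<omega> in at_right 0.
      rat_poles (rat_interpolant n \<omega> (x \<omega>)) = image_mset (\<lambda>l. s' l \<omega>) (mset_set {1..n})"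
    using small[OF \<delta>(1)]
  proof eventually_elim
    case (elim \<omega>)
    then obtain p where "monic_interp_pair n {1..2*n+1} (a \<omega>) p (q \<omega>)"
      using q(3) by blast
    then have "rat_poles (rat_interpolant n \<omega> (x \<omega>)) = image_mset (\<lambda>z. z / complex_of_real \<omega>) (proots (q \<omega>))"
      using elim unfolding a_def by (intro rat_poles_interpolant) auto
    then show ?case
      by (simp add: s(1) s'_def multiset.map_comp o_def)
  qed
  moreover have "((\<lambda>\<omega>. complex_of_real \<omega> * s' l \<omega>) \<longlongrightarrow> s_hat l) (at_right 0)" if "l \<in> {1..n}" for l
  proof (rule Lim_transform_eventually[OF s(2)[OF that]])
    show "\<forall>\<^sub>F \<omega> in at_right 0. s l \<omega> = complex_of_real \<omega> * s' l \<omega>"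
      using small[of 1, OF zero_less_one] by eventually_elim (simp add: s'_def)
  qed
  ultimately show ?thesis
    by blast
qed

theorem propositionA4:
  fixes n :: nat
  assumes "n \<ge> 1"
  shows "\<exists>s_hat :: nat \<Rightarrow> complex.
    rat_poles (pade_exp n) = image_mset s_hat (mset_set {1..n}) \<and>
    (\<forall>x :: nat \<Rightarrow> real. (\<forall>j\<in>{1..2*n+1}. x j \<in> {-1..1}) \<longrightarrow>
      (\<exists>s :: nat \<Rightarrow> real \<Rightarrow> complex.
        (\<forall>\<^sub>F \<omega> in at_right 0.
           rat_poles (rat_interpolant n \<omega> x) = image_mset (\<lambda>l. s l \<omega>) (mset_set {1..n})) \<and>
        (\<forall>l\<in>{1..n}. ((\<lambda>\<omega>. complex_of_real \<omega> * s l \<omega>) \<longlongrightarrow> s_hat l) (at_right 0)))) \<and>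
    (\<forall>x :: real \<Rightarrow> nat \<Rightarrow> real. (\<forall>\<omega>>0. \<forall>j\<in>{1..2*n+1}. x \<omega> j \<in> {-1..1}) \<longrightarrow>
      (\<exists>s :: nat \<Rightarrow> real \<Rightarrow> complex.
        (\<forall>\<^sub>F \<omega> in at_right 0.
           rat_poles (rat_interpolant n \<omega> (x \<omega>)) = image_mset (\<lambda>l. s l \<omega>) (mset_set {1..n})) \<and>
        (\<forall>l\<in>{1..n}. ((\<lambda>\<omega>. complex_of_real \<omega> * s l \<omega>) \<longlongrightarrow> s_hat l) (at_right 0))))"
proof -
  obtain \<delta> where \<delta>: "\<delta> > 0" "\<And>(K :: nat set) a. \<lbrakk>finite K; card K = 2 * n + 1; \<forall>j\<in>K. norm (a j) \<le> \<delta>\<rbrakk> \<Longrightarrow>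
      \<exists>p q. monic_interp_pair n K a p q"
    using monic_interp_pair_exists[of n] by metis
  obtain P0 Q0 where pade: "monic_interp_pair n {..<2 * n + 1} (\<lambda>_. 0 :: complex) P0 Q0"
    using \<delta>(2)[of "{..<2 * n + 1}" "\<lambda>_. 0"] \<delta>(1) by auto
  have PQ: "degree P0 \<le> n" "degree Q0 = n" "lead_coeff Q0 = 1" "coprime P0 Q0"
      "hermite_interp exp {..<2 * n + 1} (\<lambda>_. 0) P0 Q0"
    using pade by (auto simp: monic_interp_pair_def)
  \<comment> \<open>At the node 0 numerator and denominator agree, so by coprimality neither vanishes there.\<close>
  obtain v where "poly P0 z - poly Q0 z * exp z = (\<Prod>k<2 * n + 1. z - 0) * v z" for z
    using PQ(5) unfolding hermite_interp_def by blast
  from this[of 0] have "poly P0 0 = poly Q0 0"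
    by simp
  then have "poly Q0 0 \<noteq> 0"
    using coprime_poly_0[OF PQ(4), of 0] by auto
  then have "pade_exp n = Fract P0 Q0"
    by (intro pade_exp_eq) (use PQ in auto)
  moreover have "Q0 \<noteq> 0"
    using PQ(3) by auto
  ultimately have poles: "rat_poles (pade_exp n) = proots Q0"
    using rat_poles_Fract[OF PQ(4)] by simp
  obtain ss where ss: "mset ss = proots Q0"
    using ex_mset by blast
  then have "length ss = n"
    using size_proots_complex[of Q0] PQ(2) by (metis size_mset)
  define s_hat where "s_hat l = ss ! (l - 1)" for l
  have "map s_hat [1..<Suc n] = ss"
    using \<open>length ss = n\<close> by (intro nth_equalityI) (auto simp: s_hat_def nth_upt simp del: upt_Suc)
  then have "image_mset s_hat (mset_set {1..n}) = proots Q0"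
    by (metis ss mset_map mset_upt atLeastLessThanSuc_atLeastAtMost)
  then show ?thesis
    using poles_converge[OF pade, of s_hat] poles
    by (intro exI[of _ s_hat]) (auto intro!: poles_converge[OF pade])
qed

end
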